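(* Let $D\subset\mathbb{R}^s$ be a convex polyhedral set, let $g:\mathbb{R}^l\times\mathbb{R}^n\times\mathbb{R}^n\to\mathbb{R}^s$ be twice continuously differentiable, and let $\Gamma(p,x):=\{z\in\mathbb{R}^n: g(p,x,z)\in D\}$. Let $(\bar p,\bar x)$ satisfy $g(\bar p,\bar x,\bar x)\in D$ and assume that there is $\kappa>0$ such that $\mathrm{dist}(z,\Gamma(p,x))\le\kappa\,\mathrm{dist}(g(p,x,z),D)$ for all $(p,x,z)$ in a neighbourhood of $(\bar p,\bar x,\bar x)$. For $y=(p,x)$ put $\tilde g(y)=g(p,x,x)$ and $\beta(y)=\nabla_3g(p,x,x)$. Let $y=(p,x)$ be sufficiently close to $(\bar p,\bar x)$ and let $v=(q,u)\in\mathbb{R}^l\times\mathbb{R}^n$ be such that both \[\nabla\tilde g(y)^T\mu=0,\ \ \mu\in\mathrm{sp}\,N_{T_D(\tilde g(y))}(\nabla\tilde g(y)v)\ \Longrightarrow\ \mu=0\] and \[\beta(y)^T\mu=0,\ \ \mu\in\mathrm{sp}\,N_{T_D(\tilde g(y))}(\nabla\tilde g(y)v)\ \Longrightarrow\ \mu=0\] hold. Then the normal cone mapping $\mathcal{N}^\Gamma:(p',x')\rightrightarrows N_{\Gamma(p',x')}(x')$ is semismooth* at $(y,x^* )=(p,x,x^* )$ in direction $(v,u^* )=(q,u,u^* )$ for every $x^*,u^*\in\mathbb{R}^n$, i.e., \[\langle v,w\rangle=\langle u^*,w^*\rangle\qquad\forall\,(w^*,w)\in\mathrm{gph}\,D^*\mathcal{N}^\Gamma((y,x^*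 );(v,u^* )).\]
   Context: $\nabla_3g$ is the partial Jacobian with respect to the third variable. $\mathrm{dist}(\cdot,\emptyset)=\infty$. A convex polyhedral set is a finite intersection of halfspaces. For a closed set $\Omega$ and $\bar z\in\Omega$: $T_\Omega(\bar z)=\{w:\exists t_k\downarrow0,\,w_k\to w,\ \bar z+t_kw_k\in\Omega\ \forall k\}$; $\widehat N_\Omega(\bar z)=T_\Omega(\bar z)^\circ$ (negative polar); limiting normal cone $N_\Omega(\bar z)=\{z^*:\exists z_k\to\bar z,\ z_k^*\to z^*,\ z_k^*\in\widehat N_\Omega(z_k)\}$ (the usual normal cone if $\Omega$ is convex); directional limiting normal cone $N_\Omega(\bar z;w)=\{z^*:\exists t_k\downarrow0,\ w_k\to w,\ z_k^*\to z^*,\ z_k^*\in\widehat N_\Omega(\bar z+t_kw_k)\}$. All are empty at points outside $\Omega$. $\mathrm{sp}\,A$ is the linear hull of $A$, with $\mathrm{sp}\,\emptyset=\{0\}$. Directional limiting coderivative: $D^*M((\bar x,\bar y);(u,v))(v^* )=\{u^*:(u^*,-v^* )\in N_{\mathrm{gph}\,M}((\bar x,\bar y);(u,v))\}$ (empty if $(\bar x,\bar y)\notin\mathrm{gph}\,M$). *)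

theory Defs
  imports "HOL-Analysis.Analysis"
begin

text \<open>Unlike \<open>infdist\<close> and \<open>setdist\<close>, this gives the distance \<open>\<infinity>\<close> to the empty set.\<close>

definition set_edist :: "'a::metric_space \<Rightarrow> 'a set \<Rightarrow> ereal" where
  "set_edist z A = (INF a\<in>A. ereal (dist z a))"

definition twice_continuously_differentiable ::
    "('a::real_normed_vector \<Rightarrow> 'b::real_normed_vector) \<Rightarrow> bool" where
  "twice_continuously_differentiable f \<longleftrightarrow>
     (\<exists>(f' :: 'a \<Rightarrow> 'a \<Rightarrow>\<^sub>L 'b) (f'' :: 'a \<Rightarrow> 'a \<Rightarrow>\<^sub>L ('a \<Rightarrow>\<^sub>L 'b)).
        (\<forall>x. (f has_derivative blinfun_apply (f' x)) (at x)) \<and>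
        (\<forall>x. (f' has_derivative blinfun_apply (f'' x)) (at x)) \<and>
        continuous_on UNIV f'')"

text \<open>
  All cones are empty at points outside the set. The sets are not required to be closed,
  since the definitions are also applied to graphs of set-valued mappings.
  As usual, \<open>t\<^sub>k \<down> 0\<close> means \<open>t\<^sub>k > 0\<close> and \<open>t\<^sub>k \<rightarrow> 0\<close>.
\<close>

definition tangent_cone :: "'a::real_normed_vector set \<Rightarrow> 'a \<Rightarrow> 'a set" where
  "tangent_cone \<Omega> z =
     {w. z \<in> \<Omega> \<and>
         (\<exists>(t :: nat \<Rightarrow> real) (ws :: nat \<Rightarrow> 'a).
            (\<forall>k. 0 < t k) \<and> t \<longlonglongrightarrow> 0 \<and> ws \<longlonglongrightarrow> w \<and> (\<forall>k. z + t k *\<^sub>R ws k \<in> \<Omega>))}"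

definition polar_cone :: "'a::real_inner set \<Rightarrow> 'a set" where
  "polar_cone K = {zs. \<forall>w\<in>K. zs \<bullet> w \<le> 0}"

definition regular_normal_cone :: "'a::real_inner set \<Rightarrow> 'a \<Rightarrow> 'a set" where
  "regular_normal_cone \<Omega> z = (if z \<in> \<Omega> then polar_cone (tangent_cone \<Omega> z) else {})"

definition limiting_normal_cone :: "'a::real_inner set \<Rightarrow> 'a \<Rightarrow> 'a set" where
  "limiting_normal_cone \<Omega> z =
     {zs. z \<in> \<Omega> \<and>
          (\<exists>(zk :: nat \<Rightarrow> 'a) (zsk :: nat \<Rightarrow> 'a).
             zk \<longlonglongrightarrow> z \<and> zsk \<longlonglongrightarrow> zs \<and> (\<forall>k. zsk k \<in> regular_normal_cone \<Omega> (zk k)))}"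

definition dir_limiting_normal_cone :: "'a::real_inner set \<Rightarrow> 'a \<Rightarrow> 'a \<Rightarrow> 'a set" where
  "dir_limiting_normal_cone \<Omega> z w =
     {zs. z \<in> \<Omega> \<and>
          (\<exists>(t :: nat \<Rightarrow> real) (ws :: nat \<Rightarrow> 'a) (zsk :: nat \<Rightarrow> 'a).
             (\<forall>k. 0 < t k) \<and> t \<longlonglongrightarrow> 0 \<and> ws \<longlonglongrightarrow> w \<and> zsk \<longlonglongrightarrow> zs \<and>
             (\<forall>k. zsk k \<in> regular_normal_cone \<Omega> (z + t k *\<^sub>R ws k)))}"

definition gph :: "('a \<Rightarrow> 'b set) \<Rightarrow> ('a \<times> 'b) set" where
  "gph M = {(x, y). y \<in> M x}"

definition dir_limiting_coderivative ::
    "('a::real_inner \<Rightarrow> 'b::real_inner set) \<Rightarrow> 'a \<times> 'b \<Rightarrow> 'a \<times> 'b \<Rightarrow> 'b \<Rightarrow> 'a set" where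
  "dir_limiting_coderivative M z d vs =
     {us. (us, - vs) \<in> dir_limiting_normal_cone (gph M) z d}"

definition semismooth_star_in_direction ::
    "('a::real_inner \<Rightarrow> 'b::real_inner set) \<Rightarrow> 'a \<times> 'b \<Rightarrow> 'a \<times> 'b \<Rightarrow> bool" where
  "semismooth_star_in_direction M z d \<longleftrightarrow>
     (\<forall>(ws, w) \<in> gph (dir_limiting_coderivative M z d). fst d \<bullet> w = snd d \<bullet> ws)"

definition constraint_map ::
    "('p \<times> 'x \<times> 'x \<Rightarrow> 's) \<Rightarrow> 's set \<Rightarrow> 'p \<times> 'x \<Rightarrow> 'x set" where
  "constraint_map g D = (\<lambda>(p, x). {z. g (p, x, z) \<in> D})"

definition normal_cone_map ::
    "('p \<times> 'x \<times> 'x \<Rightarrow> 's) \<Rightarrow> 's set \<Rightarrow> 'p \<times> 'x \<Rightarrow> 'x::real_inner set" where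
  "normal_cone_map g D = (\<lambda>(p, x). limiting_normal_cone (constraint_map g D (p, x)) x)"

definition g_tilde :: "('p \<times> 'x \<times> 'x \<Rightarrow> 's) \<Rightarrow> 'p \<times> 'x \<Rightarrow> 's" where
  "g_tilde g = (\<lambda>(p, x). g (p, x, x))"

text \<open>
  Jacobians are represented as linear maps, and their transposes as adjoints with respect to
  the Euclidean inner products (the one on a product being the sum of the two).
\<close>

definition grad_g_tilde ::
    "('p::real_normed_vector \<times> 'x::real_normed_vector \<times> 'x \<Rightarrow> 's::real_normed_vector)
       \<Rightarrow> 'p \<times> 'x \<Rightarrow> 'p \<times> 'x \<Rightarrow> 's" where
  "grad_g_tilde g y = frechet_derivative (g_tilde g) (at y)"

definition beta ::
    "('p \<times> 'x \<times> 'x \<Rightarrow> 's) \<Rightarrow> 'p \<times> 'x \<Rightarrow> 'x::real_normed_vector \<Rightarrow> 's::real_normed_vector" where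
  "beta g = (\<lambda>(p, x). frechet_derivative (\<lambda>z. g (p, x, z)) (at x))"

end

theory Submission
  imports Defs
begin

text \<open>
  Write \<open>D\<close> as a finite intersection of halfspaces, let \<open>A(d)\<close> be the set of normals of the
  halfspaces that are active at \<open>d\<close>, and let \<open>B(y)\<close> be the transpose of \<open>\<beta>(y)\<close>. The convex cone
  generated by \<open>A(d)\<close> is the normal cone to \<open>D\<close> at \<open>d \<in> D\<close>. Put \<open>G(p,x) = g(p,x,x)\<close>; if
  \<open>G(y) \<in> D\<close> and \<open>B(y)\<close> is injective on \<open>span A(G(y))\<close>, the elements of the normal cone mapping at \<open>y\<close> are
  exactly the vectors \<open>B(y)\<lambda>\<close> with a multiplier \<open>\<lambda>\<close> in this cone.

  Let \<open>(y\<^sub>k, x\<^sub>k\<^sup>*)\<close> be graph points approaching \<open>(y, x\<^sup>*)\<close> along \<open>(v, u\<^sup>*)\<close>, with regular normals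
  converging to \<open>(w, -w\<^sup>*)\<close>. For large \<open>k\<close> every normal active at \<open>G(y\<^sub>k)\<close> is active at
  \<open>G(y)\<close> and orthogonal to \<open>\<nabla>G(y)v\<close>. These critical normals lie in the normal cone to
  \<open>T\<^sub>D(G(y))\<close> at \<open>\<nabla>G(y)v\<close>, so both transposed Jacobians are injective on their span, uniformly
  near \<open>y\<close>. Consequently the multipliers \<open>\<lambda>\<^sub>k\<close> of \<open>x\<^sub>k\<^sup>*\<close> and the difference quotients
  \<open>(\<lambda>\<^sub>k - \<lambda>)/t\<^sub>k\<close> converge, say to \<open>\<lambda>\<close> and \<open>\<eta>\<close> (lemma \<open>preimages_converge_if_images_converge\<close>), and
  differentiating \<open>x\<^sub>k\<^sup>* = B(y\<^sub>k)\<lambda>\<^sub>k\<close> along the sequence gives \<open>u\<^sup>* = (B'(y)v)\<lambda> + B(y)\<eta>\<close>. On a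
  subsequence all \<open>\<lambda>\<^sub>k\<close> are strictly positive combinations of one fixed set \<open>J\<close> of active normals,
  and then \<open>\<eta> \<in> span J\<close>.

  The graph contains a smooth piece through \<open>(y\<^sub>k, x\<^sub>k\<^sup>*)\<close>: move \<open>y\<close> so that the inner products of
  \<open>G(y)\<close> with the critical normals do not change, and move \<open>\<lambda>\<close> within \<open>span J\<close>. Its tangent space
  (lemma \<open>graph_tangent_direction\<close>) contains \<open>(v'\<^sub>k, (B'(y\<^sub>k)v'\<^sub>k)\<lambda>\<^sub>k + B(y\<^sub>k)\<eta>)\<close> whenever
  \<open>\<nabla>G(y\<^sub>k)v'\<^sub>k\<close> is orthogonal to the critical normals, and uniform injectivity provides such \<open>v'\<^sub>k\<close>
  converging to \<open>v\<close>. A regular normal is orthogonal to every tangent direction whose negative is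
  tangent as well. In the limit \<open>(w, -w\<^sup>*)\<close> is orthogonal to \<open>(v, u\<^sup>*)\<close>, which is the claim.

  The tangent directions, here as well as in the description of the normal cones, come from
  curves \<open>y + t v + o(t)\<close> along which finitely many scalar constraints stay affine in \<open>t\<close>; these are
  found with Brouwer's fixed point theorem (lemma \<open>solution_near_direction\<close>).
\<close>

section \<open>Difference quotients along converging directions\<close>

lemma has_derivative_directional_sequentially:
  fixes f :: "'a::real_normed_vector \<Rightarrow> 'b::real_normed_vector"
  assumes f: "(f has_derivative f') (at x)"
    and t: "\<And>k::nat. 0 < t k" "t \<longlonglongrightarrow> 0" and w: "w \<longlonglongrightarrow> v"
  shows "(\<lambda>k. (f (x + t k *\<^sub>R w k) - f x) /\<^sub>R t k) \<longlonglongrightarrow> f' v"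
proof -
  have bl: "bounded_linear f'"
    using f by (rule has_derivative_bounded_linear)
  have tw: "(\<lambda>k. t k *\<^sub>R w k) \<longlonglongrightarrow> 0"
    using tendsto_scaleR[OF t(2) w] by simp
  obtain M where M: "\<And>k. norm (w k) \<le> M"
    using convergent_imp_Bseq[OF convergentI[OF w]] unfolding Bseq_def by blast
  have "(\<lambda>k. (f (x + t k *\<^sub>R w k) - f x) /\<^sub>R t k - f' (w k)) \<longlonglongrightarrow> 0"
  proof (rule LIMSEQ_I)
    fix r :: real assume "0 < r"
    define e where "e = r / (2 * (\<bar>M\<bar> + 1))"
    have "e > 0" using \<open>0 < r\<close> by (simp add: e_def)
    then obtain d where d: "d > 0"
      "\<And>y. norm (y - x) < d \<Longrightarrow> norm (f y - f x - f' (y - x)) \<le> e * norm (y - x)"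
      using f unfolding has_derivative_at_alt by blast
    obtain N where N: "\<And>k. k \<ge> N \<Longrightarrow> norm (t k *\<^sub>R w k) < d"
      using LIMSEQ_D[OF tw d(1)] by auto
    have "norm ((f (x + t k *\<^sub>R w k) - f x) /\<^sub>R t k - f' (w k)) < r" if "k \<ge> N" for k
    proof -
      have "norm (f (x + t k *\<^sub>R w k) - f x - f' (t k *\<^sub>R w k)) \<le> e * norm (t k *\<^sub>R w k)"
        using d(2)[of "x + t k *\<^sub>R w k"] N[OF that] by simp
      moreover have "(f (x + t k *\<^sub>R w k) - f x) /\<^sub>R t k - f' (w k) =
          (f (x + t k *\<^sub>R w k) - f x - f' (t k *\<^sub>R w k)) /\<^sub>R t k"
        using t(1)[of k] by (simp add: linear_scale[OF bounded_linear.linear[OF bl]] scaleR_diff_right)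
      ultimately have "norm ((f (x + t k *\<^sub>R w k) - f x) /\<^sub>R t k - f' (w k)) \<le>
          (e * norm (t k *\<^sub>R w k)) / t k"
        using t(1)[of k] by (simp only: norm_scaleR) (simp add: divide_simps mult_ac)
      then have "norm ((f (x + t k *\<^sub>R w k) - f x) /\<^sub>R t k - f' (w k)) \<le> e * norm (w k)"
        using t(1)[of k] by simp
      also have "\<dots> \<le> e * (\<bar>M\<bar> + 1)"
        using M[of k] \<open>e > 0\<close> by (intro mult_left_mono) auto
      also have "\<dots> < r"
      proof -
        have "\<bar>M\<bar> + 1 > 0" by linarith
        then show ?thesis using \<open>0 < r\<close> by (simp add: e_def divide_simps)
      qed
      finally show ?thesis .
    qed
    then show "\<exists>N. \<forall>k\<ge>N. norm ((f (x + t k *\<^sub>R w k) - f x) /\<^sub>R t k - f' (w k) - 0) < r"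
      by auto
  qed
  from tendsto_add[OF this bounded_linear.tendsto[OF bl w]] show ?thesis by simp
qed

lemma tangent_coneI_eventually:
  assumes "z \<in> \<Omega>" and t: "\<And>k::nat. 0 < t k" "t \<longlonglongrightarrow> 0" and w: "ws \<longlonglongrightarrow> w"
    and ev: "\<forall>\<^sub>F k in sequentially. z + t k *\<^sub>R ws k \<in> \<Omega>"
  shows "w \<in> tangent_cone \<Omega> z"
proof -
  obtain K where K: "\<And>k. k \<ge> K \<Longrightarrow> z + t k *\<^sub>R ws k \<in> \<Omega>"
    using ev unfolding eventually_sequentially by blast
  show ?thesis
    unfolding tangent_cone_def mem_Collect_eq
    by (intro conjI exI[of _ "\<lambda>k. t (k + K)"] exI[of _ "\<lambda>k. ws (k + K)"])
      (use assms K in \<open>auto intro: LIMSEQ_ignore_initial_segment\<close>)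
qed

section \<open>Transposes and uniform injectivity on a subspace\<close>

text \<open>
  The adjoint as a bounded linear map between normed spaces of operators, so that continuity and
  derivatives of operator-valued maps pass to their transposes.
\<close>

definition transpose_blinfun ::
    "('a::euclidean_space \<Rightarrow>\<^sub>L 'b::euclidean_space) \<Rightarrow> 'b \<Rightarrow>\<^sub>L 'a" where
  "transpose_blinfun L = Blinfun (adjoint (blinfun_apply L))"

lemma blinfun_linear: "linear (blinfun_apply L)"
  by (rule bounded_linear.linear[OF blinfun.bounded_linear_right])

lemma transpose_blinfun_apply:
  "blinfun_apply (transpose_blinfun L) = adjoint (blinfun_apply L)"
  unfolding transpose_blinfun_def
  using adjoint_linear[OF blinfun_linear] linear_conv_bounded_linear
  by (blast intro: bounded_linear_Blinfun_apply)

lemma inner_transpose: "x \<bullet> transpose_blinfun L y = L x \<bullet> y"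
  by (simp add: transpose_blinfun_apply adjoint_works blinfun_linear)

lemma norm_transpose_blinfun_le: "norm (transpose_blinfun L) \<le> norm L"
proof (rule norm_blinfun_bound)
  fix y
  let ?u = "transpose_blinfun L y"
  have "norm ?u * norm ?u = L ?u \<bullet> y"
    by (simp add: inner_transpose[symmetric] power2_norm_eq_inner[symmetric] power2_eq_square)
  also have "\<dots> \<le> norm (L ?u) * norm y"
    by (rule norm_cauchy_schwarz)
  also have "\<dots> \<le> (norm L * norm ?u) * norm y"
    by (intro mult_right_mono norm_blinfun) auto
  finally have "norm ?u * norm ?u \<le> (norm L * norm y) * norm ?u"
    by (simp add: mult_ac)
  then show "norm ?u \<le> norm L * norm y"
    by (cases "norm ?u = 0") (auto simp: mult_le_cancel_right)
qed simp

lemma bounded_linear_transpose_blinfun: "bounded_linear transpose_blinfun"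
proof (rule bounded_linear_intro[where K = 1])
  fix L M :: "'a \<Rightarrow>\<^sub>L 'b" and r :: real
  show "transpose_blinfun (L + M) = transpose_blinfun L + transpose_blinfun M"
    by (rule blinfun_eqI, rule vector_eq_ldot[THEN iffD1])
      (simp add: inner_transpose blinfun.add_left inner_add_left inner_add_right)
  show "transpose_blinfun (r *\<^sub>R L) = r *\<^sub>R transpose_blinfun L"
    by (rule blinfun_eqI, rule vector_eq_ldot[THEN iffD1])
      (simp add: inner_transpose blinfun.scaleR_left)
  show "norm (transpose_blinfun L) \<le> norm L * 1"
    by (simp add: norm_transpose_blinfun_le)
qed

lemma injective_bounded_below:
  fixes B :: "'a::euclidean_space \<Rightarrow>\<^sub>L 'b::euclidean_space"
  assumes V: "subspace V" and inj: "\<forall>\<mu>\<in>V. B \<mu> = 0 \<longrightarrow> \<mu> = 0"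
  obtains c where "c > 0" "\<forall>\<mu>\<in>V. c * norm \<mu> \<le> norm (B \<mu>)"
  using injective_imp_isometric[OF closed_subspace[OF V] V blinfun.bounded_linear_right, of B] inj
  by (metis mult.commute)

text \<open>
  On a finite-dimensional subspace an injective operator is bounded below by some \<open>c\<close>, and
  perturbations of norm less than \<open>c / 2\<close> cost at most half of this bound.
\<close>

lemma injective_eventually_bounded_below:
  fixes B :: "'a::euclidean_space \<Rightarrow>\<^sub>L 'b::euclidean_space"
  assumes V: "subspace V" and inj: "\<forall>\<mu>\<in>V. B \<mu> = 0 \<longrightarrow> \<mu> = 0"
    and Bk: "Bk \<longlonglongrightarrow> B"
  obtains c where "c > 0" "\<forall>\<^sub>F k in sequentially. \<forall>\<mu>\<in>V. c * norm \<mu> \<le> norm (Bk k \<mu>)"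
proof -
  obtain c where c: "c > 0" "\<forall>\<mu>\<in>V. c * norm \<mu> \<le> norm (B \<mu>)"
    using injective_bounded_below[OF V inj] by blast
  have "\<forall>\<^sub>F k in sequentially. norm (Bk k - B) < c / 2"
    using Bk c(1) unfolding tendsto_iff dist_norm by (meson half_gt_zero)
  then have "\<forall>\<^sub>F k in sequentially. \<forall>\<mu>\<in>V. c / 2 * norm \<mu> \<le> norm (Bk k \<mu>)"
  proof (rule eventually_mono, intro ballI)
    fix k \<mu> assume k: "norm (Bk k - B) < c / 2" and "\<mu> \<in> V"
    have "norm ((Bk k - B) \<mu>) \<le> c / 2 * norm \<mu>"
      using norm_blinfun[of "Bk k - B" \<mu>] k by (meson less_imp_le mult_right_mono norm_ge_zero order_trans)
    moreover have "norm (B \<mu>) \<le> norm (Bk k \<mu>) + norm ((Bk k - B) \<mu>)"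
      using norm_triangle_ineq4[of "Bk k \<mu>" "(Bk k - B) \<mu>"] by (simp add: blinfun.diff_left)
    ultimately show "c / 2 * norm \<mu> \<le> norm (Bk k \<mu>)"
      using c(2) \<open>\<mu> \<in> V\<close> by fastforce
  qed
  then show thesis using that[of "c / 2"] c(1) by simp
qed

text \<open>
  The uniform lower bound keeps the preimages bounded, so that replacing the varying operator by
  its limit changes the images by a null sequence only; the lower bound for the limit operator then
  makes the preimages a Cauchy sequence. This yields the convergence of multipliers and of their
  difference quotients.
\<close>

lemma preimages_converge_if_images_converge:
  fixes B :: "'a::euclidean_space \<Rightarrow>\<^sub>L 'b::euclidean_space"
  assumes V: "subspace V" and inj: "\<forall>\<mu>\<in>V. B \<mu> = 0 \<longrightarrow> \<mu> = 0"
    and Bk: "Bk \<longlonglongrightarrow> B" and \<mu>V: "\<And>k. \<mu> k \<in> V" and lim: "(\<lambda>k. Bk k (\<mu> k)) \<longlonglongrightarrow> \<rho>"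
  obtains \<mu>' where "\<mu>' \<in> V" "\<mu> \<longlonglongrightarrow> \<mu>'" "B \<mu>' = \<rho>"
proof -
  obtain c where c: "c > 0" "\<forall>\<mu>\<in>V. c * norm \<mu> \<le> norm (B \<mu>)"
    using injective_bounded_below[OF V inj] by blast
  obtain c' where c': "c' > 0" "\<forall>\<^sub>F k in sequentially. \<forall>\<mu>\<in>V. c' * norm \<mu> \<le> norm (Bk k \<mu>)"
    using injective_eventually_bounded_below[OF V inj Bk] by blast
  obtain M where M: "\<And>k. norm (Bk k (\<mu> k)) \<le> M"
    using convergent_imp_Bseq[OF convergentI[OF lim]] unfolding Bseq_def by blast
  have bd: "\<forall>\<^sub>F k in sequentially. norm (\<mu> k) \<le> M / c'"
    using c'(2)
  proof eventually_elim
    case (elim k)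
    then have "c' * norm (\<mu> k) \<le> M" using M[of k] \<mu>V[of k] by force
    then show ?case using c'(1) by (simp add: field_simps)
  qed
  have "(\<lambda>k. (Bk k - B) (\<mu> k)) \<longlonglongrightarrow> 0"
  proof (rule Lim_null_comparison)
    show "\<forall>\<^sub>F k in sequentially. norm ((Bk k - B) (\<mu> k)) \<le> norm (Bk k - B) * (M / c')"
      using bd by eventually_elim
        (meson mult_left_mono norm_blinfun norm_ge_zero order_trans)
    show "(\<lambda>k. norm (Bk k - B) * (M / c')) \<longlonglongrightarrow> 0"
      by (rule tendsto_mult_left_zero[OF tendsto_norm_zero[OF LIM_zero[OF Bk]]])
  qed
  from tendsto_diff[OF lim this] have B\<mu>: "(\<lambda>k. B (\<mu> k)) \<longlonglongrightarrow> \<rho>"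
    by (simp add: blinfun.diff_left)
  have "Cauchy \<mu>"
  proof (rule metric_CauchyI)
    fix e :: real assume "0 < e"
    then obtain N where N: "\<And>m n. m \<ge> N \<Longrightarrow> n \<ge> N \<Longrightarrow> dist (B (\<mu> m)) (B (\<mu> n)) < c * e"
      using metric_CauchyD[OF LIMSEQ_imp_Cauchy[OF B\<mu>], of "c * e"] c(1) by auto
    have "dist (\<mu> m) (\<mu> n) < e" if "m \<ge> N" "n \<ge> N" for m n
    proof -
      have "c * norm (\<mu> m - \<mu> n) \<le> norm (B (\<mu> m - \<mu> n))"
        using c(2) subspace_diff[OF V \<mu>V \<mu>V] by blast
      also have "\<dots> < c * e"
        using N[OF that] by (simp add: dist_norm blinfun.diff_right)
      finally show ?thesis using c(1) by (simp add: dist_norm)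
    qed
    then show "\<exists>M. \<forall>m\<ge>M. \<forall>n\<ge>M. dist (\<mu> m) (\<mu> n) < e" by blast
  qed
  then obtain \<mu>' where \<mu>': "\<mu> \<longlonglongrightarrow> \<mu>'"
    using Cauchy_convergent convergent_def by blast
  have "\<mu>' \<in> V"
    using closed_sequentially[OF closed_subspace[OF V] _ \<mu>'] \<mu>V by blast
  moreover have "B \<mu>' = \<rho>"
    using LIMSEQ_unique[OF bounded_linear.tendsto[OF blinfun.bounded_linear_right \<mu>'] B\<mu>] by simp
  ultimately show thesis using that \<mu>' by blast
qed

section \<open>Solving equations along a direction\<close>

lemma orthogonal_projection_exists:
  fixes V :: "'a::euclidean_space set"
  assumes "subspace V"
  obtains P where "linear P" "\<forall>\<xi>. P \<xi> \<in> V" "\<forall>\<xi>. \<forall>\<mu>\<in>V. \<mu> \<bullet> P \<xi> = \<mu> \<bullet> \<xi>"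
proof -
  obtain B where B: "B \<subseteq> V" "pairwise orthogonal B" "\<And>b. b \<in> B \<Longrightarrow> norm b = 1"
      "independent B" "span B = V"
    using orthonormal_basis_subspace[OF assms] by metis
  have fin: "finite B" using B(4) by (rule independent_imp_finite)
  define P where "P = (\<lambda>\<xi>. \<Sum>b\<in>B. (b \<bullet> \<xi>) *\<^sub>R b)"
  have "linear P"
    unfolding P_def
    by (intro linear_compose_sum ballI linearI)
      (simp_all add: inner_add_right scaleR_add_left)
  moreover have "P \<xi> \<in> V" for \<xi>
    unfolding P_def using B(1) assms by (intro subspace_sum subspace_scale) auto
  moreover have "\<mu> \<bullet> P \<xi> = \<mu> \<bullet> \<xi>" if "\<mu> \<in> V" for \<mu> \<xi>
  proof -
    have eq: "b \<bullet> P \<xi> = b \<bullet> \<xi>" if "b \<in> B" for b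
    proof -
      have "b \<bullet> P \<xi> = (\<Sum>b'\<in>B. (b' \<bullet> \<xi>) * (b \<bullet> b'))"
        by (simp add: P_def inner_sum_right)
      also have "\<dots> = (\<Sum>b'\<in>B. if b' = b then b \<bullet> \<xi> else 0)"
        using B(2,3) that
        by (intro sum.cong) (auto simp: pairwise_def orthogonal_def norm_eq_1)
      finally show ?thesis using fin that by simp
    qed
    have "subspace {\<mu>. \<mu> \<bullet> (P \<xi> - \<xi>) = 0}"
      by (simp add: subspace_hyperplane2 inner_commute)
    then have "span B \<subseteq> {\<mu>. \<mu> \<bullet> (P \<xi> - \<xi>) = 0}"
      using eq by (intro span_minimal) (auto simp: inner_diff_right)
    then show ?thesis using that B(5) by (auto simp: inner_diff_right)
  qed
  ultimately show thesis using that by blast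
qed

text \<open>
  With the orthogonal projection \<open>P\<close> onto \<open>V\<close>, the map \<open>P L L\<^sup>T P + (I - P)\<close> is injective: testing
  its kernel with \<open>P \<xi>\<close> gives \<open>\<bar>L\<^sup>T P \<xi>\<bar> = 0\<close>. Hence it is invertible, and \<open>L\<^sup>T P\<close> after its inverse
  is the required \<open>R\<close>. The norm bound involves \<open>c\<close> alone, so it is uniform along a convergent
  sequence of operators.
\<close>

lemma right_inverse_modulo_subspace:
  fixes L :: "'a::euclidean_space \<Rightarrow>\<^sub>L 'b::euclidean_space"
  assumes V: "subspace V" and c: "c > 0"
    and below: "\<forall>\<mu>\<in>V. c * norm \<mu> \<le> norm (transpose_blinfun L \<mu>)"
  obtains R where "bounded_linear R" "\<forall>\<xi>. \<forall>\<mu>\<in>V. \<mu> \<bullet> L (R \<xi>) = \<mu> \<bullet> \<xi>"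
    "\<forall>\<xi>. norm (R \<xi>) \<le> norm \<xi> / c"
proof -
  obtain P where P: "linear P" "\<forall>\<xi>. P \<xi> \<in> V" "\<forall>\<xi>. \<forall>\<mu>\<in>V. \<mu> \<bullet> P \<xi> = \<mu> \<bullet> \<xi>"
    using orthogonal_projection_exists[OF V] by blast
  define T where "T = (\<lambda>\<mu>. P (L (transpose_blinfun L (P \<mu>))) + (\<mu> - P \<mu>))"
  have linT: "linear T"
    unfolding T_def
    by (intro linear_compose_add linear_compose_sub linear_ident P(1)
        linear_compose[OF _ P(1), unfolded o_def] linear_compose[OF P(1), unfolded o_def]
        blinfun_linear linear_compose[OF blinfun_linear blinfun_linear, unfolded o_def]
        linear_compose[OF linear_compose[OF P(1) blinfun_linear] blinfun_linear, unfolded o_def])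
  have inner_T: "\<mu> \<bullet> T \<xi> = \<mu> \<bullet> L (transpose_blinfun L (P \<xi>))" if "\<mu> \<in> V" for \<mu> \<xi>
    using P(3) that by (simp add: T_def inner_add_right inner_diff_right)
  have "inj T"
  proof (rule linear_injective_0[OF linT, THEN iffD2], intro allI impI)
    fix \<xi> assume T0: "T \<xi> = 0"
    have "norm (transpose_blinfun L (P \<xi>)) ^ 2 = P \<xi> \<bullet> T \<xi>"
      using inner_T[of "P \<xi>" \<xi>] P(2)
      by (simp add: power2_norm_eq_inner inner_transpose inner_commute)
    then have L0: "transpose_blinfun L (P \<xi>) = 0" using T0 by simp
    then have "c * norm (P \<xi>) \<le> 0" using below[rule_format, of "P \<xi>"] P(2) by simp
    then have "P \<xi> = 0" using c by (simp add: mult_le_0_iff)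
    with T0 L0 show "\<xi> = 0" by (simp add: T_def linear_0[OF P(1)])
  qed
  then obtain U where U: "linear U" "\<And>\<xi>. T (U \<xi>) = \<xi>"
    using linear_injective_isomorphism[OF linT] by blast
  define R where "R = (\<lambda>\<xi>. transpose_blinfun L (P (U \<xi>)))"
  have "linear R"
    unfolding R_def
    using linear_compose[OF linear_compose[OF U(1) P(1)] blinfun_linear] by (simp add: o_def)
  then have "bounded_linear R" by (simp add: linear_conv_bounded_linear)
  moreover have inner_R: "\<mu> \<bullet> L (R \<xi>) = \<mu> \<bullet> \<xi>" if "\<mu> \<in> V" for \<mu> \<xi>
    using inner_T[OF that, of "U \<xi>"] U(2) by (simp add: R_def)
  moreover have "norm (R \<xi>) \<le> norm \<xi> / c" for \<xi>
  proof -
    define \<mu> where "\<mu> = P (U \<xi>)"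
    have "\<mu> \<in> V" using P(2) by (simp add: \<mu>_def)
    have R: "R \<xi> = transpose_blinfun L \<mu>" by (simp add: R_def \<mu>_def)
    have "norm (R \<xi>) * norm (R \<xi>) = \<mu> \<bullet> \<xi>"
      using inner_R[OF \<open>\<mu> \<in> V\<close>, of \<xi>] inner_transpose[of "R \<xi>" L \<mu>]
      by (simp add: R inner_commute power2_norm_eq_inner flip: power2_eq_square)
    also have "\<dots> \<le> norm \<mu> * norm \<xi>" by (rule norm_cauchy_schwarz)
    also have "\<dots> \<le> (norm (R \<xi>) / c) * norm \<xi>"
      using below \<open>\<mu> \<in> V\<close> c by (intro mult_right_mono) (auto simp: R field_simps)
    finally show ?thesis
      by (cases "norm (R \<xi>) = 0") (use c in \<open>auto simp: field_simps\<close>)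
  qed
  ultimately show thesis using that by blast
qed

text \<open>
  The correction \<open>R \<xi>\<close>, \<open>\<xi> \<in> V\<close>, is added to the step \<open>t v\<close>. To first order it changes the
  \<open>V\<close>-component of \<open>G\<close> by exactly \<open>\<xi>\<close>, so the equation for \<open>\<xi>\<close> is a fixed point problem whose
  right-hand side is the linearization error. This error is \<open>o(t)\<close>, hence maps a small ball in \<open>V\<close>,
  of radius proportional to \<open>\<epsilon> t\<close>, into itself, and Brouwer's theorem applies; unlike
  a contraction argument, it asks for differentiability at the single point \<open>y\<close> only.
\<close>

lemma solution_near_direction:
  fixes G :: "'a::euclidean_space \<Rightarrow> 'b::euclidean_space"
  assumes V: "subspace V" and contG: "continuous_on UNIV G"
    and derG: "(G has_derivative blinfun_apply L) (at y)"
    and R: "bounded_linear R" "\<forall>\<xi>. \<forall>\<mu>\<in>V. \<mu> \<bullet> L (R \<xi>) = \<mu> \<bullet> \<xi>"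
    and "\<epsilon> > 0"
  obtains \<delta> where "\<delta> > 0"
    "\<forall>t. 0 < t \<and> t < \<delta> \<longrightarrow>
      (\<exists>w. norm (w - v) \<le> \<epsilon> \<and> (\<forall>\<mu>\<in>V. \<mu> \<bullet> G (y + t *\<^sub>R w) = \<mu> \<bullet> (G y + t *\<^sub>R L v)))"
proof -
  obtain P where P: "linear P" "\<forall>\<xi>. P \<xi> \<in> V" "\<forall>\<xi>. \<forall>\<mu>\<in>V. \<mu> \<bullet> P \<xi> = \<mu> \<bullet> \<xi>"
    using orthogonal_projection_exists[OF V] by blast
  have P_le: "norm (P \<xi>) \<le> norm \<xi>" for \<xi>
  proof -
    have "norm (P \<xi>) * norm (P \<xi>) = P \<xi> \<bullet> \<xi>"
      using P(2,3) by (simp flip: power2_eq_square add: power2_norm_eq_inner)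
    also have "\<dots> \<le> norm (P \<xi>) * norm \<xi>" by (rule norm_cauchy_schwarz)
    finally show ?thesis
      by (cases "norm (P \<xi>) = 0") (auto simp: mult_le_cancel_left)
  qed
  have P_eqI: "P \<xi> = \<xi>'" if "\<xi>' \<in> V" "\<forall>\<mu>\<in>V. \<mu> \<bullet> \<xi> = \<mu> \<bullet> \<xi>'" for \<xi> \<xi>'
  proof -
    have "(P \<xi> - \<xi>') \<bullet> (P \<xi> - \<xi>') = 0"
      using that P(2,3) subspace_diff[OF V, of "P \<xi>" \<xi>'] by (simp add: inner_diff_right)
    then show ?thesis by simp
  qed
  obtain K where K: "K > 0" "\<And>\<xi>. norm (R \<xi>) \<le> norm \<xi> * K"
    using bounded_linear.pos_bounded[OF R(1)] by blast
  define e where "e = \<epsilon> / (K * (norm v + \<epsilon>))"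
  have pos: "norm v + \<epsilon> > 0" using \<open>\<epsilon> > 0\<close> by (simp add: add_nonneg_pos)
  have "e > 0" using \<open>\<epsilon> > 0\<close> K(1) pos by (simp add: e_def)
  then obtain d where d: "d > 0"
    "\<And>z. norm (z - y) < d \<Longrightarrow> norm (G z - G y - L (z - y)) \<le> e * norm (z - y)"
    using derG unfolding has_derivative_at_alt by blast
  show thesis
  proof (rule that[of "d / (norm v + \<epsilon>)"], goal_cases)
    case 1
    show ?case using d(1) pos by simp
  next
    case 2
    show ?case
    proof (intro allI impI, elim conjE)
      fix t assume t: "0 < t" "t < d / (norm v + \<epsilon>)"
      \<comment> \<open>the radius at which \<open>norm (R \<xi>) \<le> t * \<epsilon>\<close> is guaranteed; \<open>e\<close> is chosen so that the
          linearization error does not exceed it\<close>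
      define \<rho> where "\<rho> = t * \<epsilon> / K"
      define S where "S = V \<inter> cball 0 \<rho>"
      define z where "z = (\<lambda>\<xi>. y + (t *\<^sub>R v + R \<xi>))"
      define \<Phi> where "\<Phi> = (\<lambda>\<xi>. \<xi> - P (G (z \<xi>) - G y - t *\<^sub>R L v))"
      have "\<rho> \<ge> 0" using t(1) \<open>\<epsilon> > 0\<close> K(1) by (simp add: \<rho>_def)
      have R_le: "norm (R \<xi>) \<le> t * \<epsilon>" if "\<xi> \<in> S" for \<xi>
      proof -
        have "norm (R \<xi>) \<le> \<rho> * K"
          using K(2)[of \<xi>] that K(1) by (auto simp: S_def intro: order_trans mult_right_mono)
        then show ?thesis using K(1) by (simp add: \<rho>_def)
      qed
      have \<Phi>_le: "norm (\<Phi> \<xi>) \<le> \<rho>" and \<Phi>_V: "\<Phi> \<xi> \<in> V" if \<xi>: "\<xi> \<in> S" for \<xi>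
      proof -
        have "\<xi> \<in> V" using \<xi> by (simp add: S_def)
        then show "\<Phi> \<xi> \<in> V"
          unfolding \<Phi>_def using P(2) by (intro subspace_diff[OF V]) auto
        define r where "r = G (z \<xi>) - G y - L (z \<xi> - y)"
        have "norm (z \<xi> - y) \<le> norm (t *\<^sub>R v) + norm (R \<xi>)"
          using norm_triangle_ineq[of "t *\<^sub>R v" "R \<xi>"] by (simp add: z_def)
        also have "\<dots> \<le> t * (norm v + \<epsilon>)"
          using R_le[OF \<xi>] t(1) by (simp add: algebra_simps)
        finally have z_le: "norm (z \<xi> - y) \<le> t * (norm v + \<epsilon>)" .
        also have "\<dots> < d" using t(2) pos by (simp add: field_simps)
        finally have "norm r \<le> e * norm (z \<xi> - y)"
          unfolding r_def by (rule d(2))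
        also have "\<dots> \<le> e * (t * (norm v + \<epsilon>))"
          using z_le \<open>e > 0\<close> by (intro mult_left_mono) auto
        also have "\<dots> = \<rho>" using pos K(1) by (simp add: e_def \<rho>_def)
        finally have "norm r \<le> \<rho>" .
        moreover have "P (G (z \<xi>) - G y - t *\<^sub>R L v) = \<xi> + P r"
        proof (rule P_eqI)
          show "\<xi> + P r \<in> V" using \<open>\<xi> \<in> V\<close> P(2) V by (simp add: subspace_add)
          have "G (z \<xi>) - G y - t *\<^sub>R L v = L (R \<xi>) + r"
            by (simp add: r_def z_def blinfun.add_right blinfun.scaleR_right)
          then show "\<forall>\<mu>\<in>V. \<mu> \<bullet> (G (z \<xi>) - G y - t *\<^sub>R L v) = \<mu> \<bullet> (\<xi> + P r)"
            using R(2) P(3) by (simp add: inner_add_right)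
        qed
        ultimately show "norm (\<Phi> \<xi>) \<le> \<rho>"
          using P_le[of r] by (simp add: \<Phi>_def)
      qed
      have "continuous_on S z"
        unfolding z_def by (intro continuous_intros bounded_linear.continuous_on[OF R(1)])
      then have "continuous_on S (\<lambda>\<xi>. G (z \<xi>))"
        by (rule continuous_on_compose2[OF contG]) auto
      then have cont: "continuous_on S \<Phi>"
        unfolding \<Phi>_def
        by (intro continuous_on_diff continuous_on_id continuous_on_const
            linear_continuous_on_compose[OF _ P(1)])
      obtain \<xi> where \<xi>: "\<xi> \<in> S" "\<Phi> \<xi> = \<xi>"
      proof (rule brouwer[of S \<Phi>])
        show "compact S" unfolding S_def by (intro closed_Int_compact closed_subspace V compact_cball)
        show "convex S" unfolding S_def by (intro convex_Int subspace_imp_convex V convex_cball)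
        show "S \<noteq> {}" using \<open>\<rho> \<ge> 0\<close> subspace_0[OF V] by (auto simp: S_def)
        show "\<Phi> \<in> S \<rightarrow> S" using \<Phi>_le \<Phi>_V by (auto simp: S_def)
      qed (use cont in auto)
      define w where "w = v + R \<xi> /\<^sub>R t"
      have zw: "y + t *\<^sub>R w = z \<xi>" using t(1) by (simp add: w_def z_def scaleR_add_right)
      have "norm (w - v) \<le> \<epsilon>"
        using R_le[OF \<xi>(1)] t(1) by (simp add: w_def field_simps)
      moreover have "\<mu> \<bullet> G (y + t *\<^sub>R w) = \<mu> \<bullet> (G y + t *\<^sub>R L v)" if "\<mu> \<in> V" for \<mu>
      proof -
        have "P (G (z \<xi>) - G y - t *\<^sub>R L v) = 0" using \<xi>(2) by (simp add: \<Phi>_def)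
        then have "\<mu> \<bullet> (G (z \<xi>) - G y - t *\<^sub>R L v) = 0"
          using P(3) that by (metis inner_zero_right)
        then show ?thesis by (simp add: zw inner_diff_right inner_add_right)
      qed
      ultimately show "\<exists>w. norm (w - v) \<le> \<epsilon> \<and>
          (\<forall>\<mu>\<in>V. \<mu> \<bullet> G (y + t *\<^sub>R w) = \<mu> \<bullet> (G y + t *\<^sub>R L v))"
        by blast
    qed
  qed
qed

lemma tangential_solution_sequence:
  fixes G :: "'a::euclidean_space \<Rightarrow> 'b::euclidean_space"
  assumes V: "subspace V" and contG: "continuous_on UNIV G"
    and derG: "(G has_derivative blinfun_apply L) (at y)"
    and inj: "\<forall>\<mu>\<in>V. transpose_blinfun L \<mu> = 0 \<longrightarrow> \<mu> = 0"
  obtains t w where "\<forall>k::nat. 0 < t k" "t \<longlonglongrightarrow> 0" "w \<longlonglongrightarrow> v"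
    "\<forall>k. \<forall>\<mu>\<in>V. \<mu> \<bullet> G (y + t k *\<^sub>R w k) = \<mu> \<bullet> (G y + t k *\<^sub>R L v)"
proof -
  obtain c where c: "c > 0" "\<forall>\<mu>\<in>V. c * norm \<mu> \<le> norm (transpose_blinfun L \<mu>)"
    using injective_bounded_below[OF V inj] by blast
  obtain R where R: "bounded_linear R" "\<forall>\<xi>. \<forall>\<mu>\<in>V. \<mu> \<bullet> L (R \<xi>) = \<mu> \<bullet> \<xi>"
    by (rule right_inverse_modulo_subspace[OF V c])
  have "\<exists>t w. 0 < t \<and> t < inverse (real (Suc k)) \<and> norm (w - v) \<le> inverse (real (Suc k)) \<and>
      (\<forall>\<mu>\<in>V. \<mu> \<bullet> G (y + t *\<^sub>R w) = \<mu> \<bullet> (G y + t *\<^sub>R L v))" for k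
  proof -
    have pos: "inverse (real (Suc k)) > 0" by simp
    obtain \<delta> where \<delta>: "\<delta> > 0" "\<forall>t. 0 < t \<and> t < \<delta> \<longrightarrow> (\<exists>w. norm (w - v) \<le> inverse (real (Suc k)) \<and>
        (\<forall>\<mu>\<in>V. \<mu> \<bullet> G (y + t *\<^sub>R w) = \<mu> \<bullet> (G y + t *\<^sub>R L v)))"
      using solution_near_direction[OF V contG derG R pos] by blast
    define t where "t = min \<delta> (inverse (real (Suc k))) / 2"
    have "0 < t" "t < \<delta>" "t < inverse (real (Suc k))"
      using \<delta>(1) pos unfolding t_def by (auto simp: min_def field_simps)
    then show ?thesis using \<delta>(2) by blast
  qed
  then obtain t w where tw: "\<And>k. 0 < t k" "\<And>k. t k < inverse (real (Suc k))"
    "\<And>k. norm (w k - v) \<le> inverse (real (Suc k))"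
    "\<And>k. \<forall>\<mu>\<in>V. \<mu> \<bullet> G (y + t k *\<^sub>R w k) = \<mu> \<bullet> (G y + t k *\<^sub>R L v)"
    by metis
  have "t \<longlonglongrightarrow> 0"
    by (rule Lim_null_comparison[OF _ LIMSEQ_inverse_real_of_nat])
      (use tw(1,2) in \<open>auto intro!: always_eventually simp: less_imp_le\<close>)
  moreover have "w \<longlonglongrightarrow> v"
    by (rule LIM_zero_cancel, rule Lim_null_comparison[OF _ LIMSEQ_inverse_real_of_nat])
      (use tw(3) in \<open>auto intro!: always_eventually\<close>)
  ultimately show thesis using that tw(1,4) by blast
qed

section \<open>Polyhedra and their active normals\<close>

definition halfspace_intersection :: "('a::real_inner \<times> real) set \<Rightarrow> 'a set" where
  "halfspace_intersection H = {d. \<forall>(a, b)\<in>H. a \<bullet> d \<le> b}"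

definition active_normals :: "('a::real_inner \<times> real) set \<Rightarrow> 'a \<Rightarrow> 'a set" where
  "active_normals H d = {a. (a, a \<bullet> d) \<in> H}"

lemma polyhedron_eq_halfspace_intersection:
  fixes D :: "'a::euclidean_space set"
  assumes "polyhedron D"
  obtains H where "finite H" "D = halfspace_intersection H"
proof -
  obtain F where F: "finite F" "D = \<Inter>F" "\<forall>h\<in>F. \<exists>a b. a \<noteq> 0 \<and> h = {x. a \<bullet> x \<le> b}"
    using assms unfolding polyhedron_def by blast
  then obtain a b where ab: "\<And>h. h \<in> F \<Longrightarrow> h = {x. a h \<bullet> x \<le> b h}"
    by metis
  have "D = halfspace_intersection ((\<lambda>h. (a h, b h)) ` F)"
    unfolding F(2) halfspace_intersection_def using ab by auto
  then show thesis using that F(1) by blast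
qed

lemma finite_active_normals: "finite H \<Longrightarrow> finite (active_normals H d)"
  unfolding active_normals_def
  by (rule finite_subset[OF _ finite_imageI[of H fst]]) (auto simp: image_iff, force)

lemma active_normals_subset: "active_normals H d \<subseteq> fst ` H"
  by (force simp: active_normals_def)

lemma eventually_active_normals_subset:
  fixes d :: "'a::euclidean_space"
  assumes H: "finite H" and d: "d \<in> halfspace_intersection H" and dk: "dk \<longlonglongrightarrow> d"
  shows "\<forall>\<^sub>F k in sequentially. active_normals H (dk k) \<subseteq> active_normals H d"
proof -
  have "\<forall>\<^sub>F k in sequentially. (case h of (a, b) \<Rightarrow> a \<bullet> d < b \<longrightarrow> a \<bullet> dk k < b)" for h
  proof (cases h)
    case (Pair a b)
    have "(\<lambda>k. a \<bullet> dk k) \<longlonglongrightarrow> a \<bullet> d" by (intro tendsto_intros dk)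
    then show ?thesis
      unfolding Pair by (cases "a \<bullet> d < b") (auto dest: order_tendstoD)
  qed
  then have "\<forall>\<^sub>F k in sequentially. \<forall>h\<in>H. (case h of (a, b) \<Rightarrow> a \<bullet> d < b \<longrightarrow> a \<bullet> dk k < b)"
    using H by (simp add: eventually_ball_finite)
  then show ?thesis
    by eventually_elim (use d in \<open>force simp: active_normals_def halfspace_intersection_def\<close>)
qed

text \<open>
  Membership in a polyhedron is locally decided by the active halfspaces; the others hold
  strictly at \<open>d\<close> and persist by continuity.
\<close>

lemma eventually_mem_halfspace_intersection:
  fixes d :: "'a::euclidean_space"
  assumes H: "finite H" and d: "d \<in> halfspace_intersection H" and dk: "dk \<longlonglongrightarrow> d"
    and act: "\<And>k a. a \<in> active_normals H d \<Longrightarrow> a \<bullet> dk k \<le> a \<bullet> d"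
  shows "\<forall>\<^sub>F k in sequentially. dk k \<in> halfspace_intersection H"
proof -
  have "\<forall>\<^sub>F k in sequentially. (case h of (a, b) \<Rightarrow> a \<bullet> dk k \<le> b)" if "h \<in> H" for h
  proof (cases h)
    case (Pair a b)
    have lim: "(\<lambda>k. a \<bullet> dk k) \<longlonglongrightarrow> a \<bullet> d" by (intro tendsto_intros dk)
    have "a \<bullet> d \<le> b" using d that by (auto simp: Pair halfspace_intersection_def)
    then show ?thesis
    proof (cases "a \<bullet> d < b")
      case True
      then show ?thesis
        unfolding Pair using order_tendstoD(2)[OF lim True] by (auto elim: eventually_mono)
    next
      case False
      then have "a \<in> active_normals H d" "b = a \<bullet> d"
        using \<open>a \<bullet> d \<le> b\<close> that by (auto simp: Pair active_normals_def)
      then show ?thesis unfolding Pair using act by simp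
    qed
  qed
  then have "\<forall>\<^sub>F k in sequentially. \<forall>h\<in>H. (case h of (a, b) \<Rightarrow> a \<bullet> dk k \<le> b)"
    using H by (simp add: eventually_ball_finite)
  then show ?thesis by (simp add: halfspace_intersection_def)
qed

lemma convex_cone_hull_inner_le:
  assumes "l \<in> convex_cone hull A" "\<And>a. a \<in> A \<Longrightarrow> a \<bullet> w \<le> 0"
  shows "l \<bullet> w \<le> 0"
proof -
  have "convex_cone hull A \<subseteq> {a. w \<bullet> a \<le> 0}"
  proof (rule hull_minimal)
    show "A \<subseteq> {a. w \<bullet> a \<le> 0}" using assms(2) by (auto simp: inner_commute)
  qed (rule convex_cone_halfspace_le)
  then show ?thesis using assms(1) by (auto simp: inner_commute)
qed

lemma convex_cone_hull_subset_span: "convex_cone hull A \<subseteq> span A"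
  by (rule hull_minimal) (auto simp: span_superset convex_cone_span)

lemma Farkas_convex_cone_hull:
  fixes A :: "'a::euclidean_space set"
  assumes "finite A" and pol: "\<And>w. (\<And>a. a \<in> A \<Longrightarrow> a \<bullet> w \<le> 0) \<Longrightarrow> z \<bullet> w \<le> 0"
  shows "z \<in> convex_cone hull A"
proof (rule ccontr)
  let ?C = "convex_cone hull A"
  assume "z \<notin> ?C"
  moreover have "closed ?C"
    using assms(1) by (intro polyhedron_imp_closed polyhedron_convex_cone_hull)
  ultimately obtain w b where wb: "w \<bullet> z < b" "\<And>x. x \<in> ?C \<Longrightarrow> b < w \<bullet> x"
    using separating_hyperplane_closed_point[OF convex_convex_cone_hull] by metis
  have "b < 0" using wb(2)[OF convex_cone_hull_contains_0] by simp
  have "a \<bullet> (- w) \<le> 0" if "a \<in> A" for a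
  proof (rule ccontr)
    assume "\<not> ?thesis"
    then have neg: "w \<bullet> a < 0" by (simp add: inner_commute)
    have "(b / (w \<bullet> a)) *\<^sub>R a \<in> ?C"
      using neg \<open>b < 0\<close> that by (intro convex_cone_hull_mul hull_inc) (auto simp: divide_nonpos_neg)
    from wb(2)[OF this] neg show False by simp
  qed
  then have "z \<bullet> (- w) \<le> 0" by (rule pol)
  then show False using wb(1) \<open>b < 0\<close> by (simp add: inner_commute)
qed

text \<open>
  The set \<open>J\<close> is the support of a representation of \<open>l\<close> as a combination with positive
  coefficients: a small multiple of any \<open>\<eta> \<in> span J\<close> keeps these coefficients positive. The vectors
  that admit such a \<open>J\<close> form a convex cone containing \<open>A\<close>, so that a hull argument replaces explicit coefficients.
\<close>

lemma convex_cone_hull_support: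
  fixes A :: "'a::real_vector set"
  assumes "l \<in> convex_cone hull A"
  obtains J where "J \<subseteq> A" "l \<in> span J"
    "\<forall>\<eta>\<in>span J. \<exists>\<delta>>0. \<forall>s. 0 \<le> s \<and> s \<le> \<delta> \<longrightarrow> l + s *\<^sub>R \<eta> \<in> convex_cone hull A"
proof -
  let ?C = "convex_cone hull A"
  define inner_dirs where "inner_dirs = (\<lambda>l J. \<forall>\<eta>\<in>span J. \<exists>\<delta>>0. \<forall>s::real. 0 \<le> s \<and> s \<le> \<delta> \<longrightarrow> l + s *\<^sub>R \<eta> \<in> ?C)"
  define Q where "Q = {l. \<exists>J\<subseteq>A. l \<in> span J \<and> inner_dirs l J}"
  have "convex_cone Q"
    unfolding convex_cone_iff
  proof (intro conjI ballI allI impI)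
    show "0 \<in> Q"
      unfolding Q_def inner_dirs_def
      by (auto intro!: exI[of _ "{}"] exI[of _ 1] simp: convex_cone_hull_contains_0)
  next
    fix l1 l2 assume "l1 \<in> Q" "l2 \<in> Q"
    then obtain J1 J2 where J: "J1 \<subseteq> A" "l1 \<in> span J1" "inner_dirs l1 J1"
      "J2 \<subseteq> A" "l2 \<in> span J2" "inner_dirs l2 J2"
      unfolding Q_def by blast
    have "l1 + l2 \<in> span (J1 \<union> J2)"
      using J(2,5) by (auto simp: span_Un)
    moreover have "inner_dirs (l1 + l2) (J1 \<union> J2)"
      unfolding inner_dirs_def
    proof
      fix \<eta> assume "\<eta> \<in> span (J1 \<union> J2)"
      then obtain \<eta>1 \<eta>2 where \<eta>: "\<eta>1 \<in> span J1" "\<eta>2 \<in> span J2" "\<eta> = \<eta>1 + \<eta>2"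
        by (auto simp: span_Un)
      obtain \<delta>1 where \<delta>1: "\<delta>1 > 0" "\<And>s. 0 \<le> s \<and> s \<le> \<delta>1 \<Longrightarrow> l1 + s *\<^sub>R \<eta>1 \<in> ?C"
        using J(3) \<eta>(1) unfolding inner_dirs_def by blast
      obtain \<delta>2 where \<delta>2: "\<delta>2 > 0" "\<And>s. 0 \<le> s \<and> s \<le> \<delta>2 \<Longrightarrow> l2 + s *\<^sub>R \<eta>2 \<in> ?C"
        using J(6) \<eta>(2) unfolding inner_dirs_def by blast
      have "l1 + l2 + s *\<^sub>R \<eta> \<in> ?C" if "0 \<le> s \<and> s \<le> min \<delta>1 \<delta>2" for s
        using convex_cone_hull_add[OF \<delta>1(2)[of s] \<delta>2(2)[of s]] that
        by (simp add: \<eta>(3) scaleR_add_right algebra_simps)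
      then show "\<exists>\<delta>>0. \<forall>s. 0 \<le> s \<and> s \<le> \<delta> \<longrightarrow> l1 + l2 + s *\<^sub>R \<eta> \<in> ?C"
        using \<delta>1(1) \<delta>2(1) by (intro exI[of _ "min \<delta>1 \<delta>2"]) auto
    qed
    ultimately show "l1 + l2 \<in> Q" unfolding Q_def using J(1,4) by blast
  next
    fix l and c :: real assume "l \<in> Q" "0 \<le> c"
    show "c *\<^sub>R l \<in> Q"
    proof (cases "c = 0")
      case True
      then show ?thesis
        unfolding Q_def inner_dirs_def
        by (auto intro!: exI[of _ "{}"] exI[of _ 1] simp: convex_cone_hull_contains_0)
    next
      case False
      with \<open>0 \<le> c\<close> have "c > 0" by simp
      obtain J where J: "J \<subseteq> A" "l \<in> span J" "inner_dirs l J"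
        using \<open>l \<in> Q\<close> unfolding Q_def by blast
      have "inner_dirs (c *\<^sub>R l) J"
        unfolding inner_dirs_def
      proof
        fix \<eta> assume "\<eta> \<in> span J"
        then obtain \<delta> where \<delta>: "\<delta> > 0" "\<And>s. 0 \<le> s \<and> s \<le> \<delta> \<Longrightarrow> l + s *\<^sub>R \<eta> \<in> ?C"
          using J(3) unfolding inner_dirs_def by blast
        have "c *\<^sub>R l + s *\<^sub>R \<eta> \<in> ?C" if "0 \<le> s \<and> s \<le> c * \<delta>" for s
          using convex_cone_hull_mul[OF \<delta>(2)[of "s / c"], of c] that \<open>c > 0\<close>
          by (simp add: scaleR_add_right field_simps)
        then show "\<exists>\<delta>>0. \<forall>s. 0 \<le> s \<and> s \<le> \<delta> \<longrightarrow> c *\<^sub>R l + s *\<^sub>R \<eta> \<in> ?C"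
          using \<delta>(1) \<open>c > 0\<close> by (intro exI[of _ "c * \<delta>"]) auto
      qed
      then show ?thesis unfolding Q_def using J(1,2) by (auto intro: span_scale)
    qed
  qed
  moreover have "A \<subseteq> Q"
  proof
    fix a assume "a \<in> A"
    have "inner_dirs a {a}"
      unfolding inner_dirs_def
    proof
      fix \<eta> assume "\<eta> \<in> span {a}"
      then obtain k where k: "\<eta> = k *\<^sub>R a" by (auto simp: span_singleton)
      have "a + s *\<^sub>R \<eta> \<in> ?C" if s: "0 \<le> s \<and> s \<le> 1 / (\<bar>k\<bar> + 1)" for s
      proof -
        have "s * \<bar>k\<bar> \<le> s * (\<bar>k\<bar> + 1)" using s by (intro mult_left_mono) auto
        also have "\<dots> \<le> 1" using s by (simp add: field_simps)
        finally have "1 + s * k \<ge> 0"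
          using s abs_ge_minus_self[of "s * k"] by (simp add: abs_mult)
        then have "(1 + s * k) *\<^sub>R a \<in> ?C"
          using \<open>a \<in> A\<close> by (intro convex_cone_hull_mul hull_inc)
        then show ?thesis by (simp add: k scaleR_add_left)
      qed
      then show "\<exists>\<delta>>0. \<forall>s. 0 \<le> s \<and> s \<le> \<delta> \<longrightarrow> a + s *\<^sub>R \<eta> \<in> ?C"
        by (intro exI[of _ "1 / (\<bar>k\<bar> + 1)"]) auto
    qed
    then show "a \<in> Q" unfolding Q_def using \<open>a \<in> A\<close> by (auto intro!: exI[of _ "{a}"] span_base)
  qed
  ultimately have "?C \<subseteq> Q" by (simp add: hull_minimal)
  then show thesis using assms that unfolding Q_def inner_dirs_def by blast
qed

section \<open>Normals to smooth preimages of polyhedra\<close>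

lemma regular_subset_limiting_normal_cone:
  "regular_normal_cone \<Omega> z \<subseteq> limiting_normal_cone \<Omega> z"
proof
  fix zs assume zs: "zs \<in> regular_normal_cone \<Omega> z"
  then have "z \<in> \<Omega>" by (auto simp: regular_normal_cone_def split: if_splits)
  with zs show "zs \<in> limiting_normal_cone \<Omega> z"
    unfolding limiting_normal_cone_def mem_Collect_eq
    by (intro conjI exI[of _ "\<lambda>_::nat. z"] exI[of _ "\<lambda>_::nat. zs"]) auto
qed

lemma active_normal_inner_tangent_le:
  assumes w: "w \<in> tangent_cone (halfspace_intersection H) d" and a: "a \<in> active_normals H d"
  shows "a \<bullet> w \<le> 0"
proof -
  obtain t ws where tw: "\<And>k. 0 < t k" "ws \<longlonglongrightarrow> w"
    "\<And>k. d + t k *\<^sub>R ws k \<in> halfspace_intersection H"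
    using w unfolding tangent_cone_def by blast
  have le: "a \<bullet> ws k \<le> 0" for k
  proof -
    have "a \<bullet> (d + t k *\<^sub>R ws k) \<le> a \<bullet> d"
      using tw(3)[of k] a by (auto simp: halfspace_intersection_def active_normals_def)
    then show ?thesis
      using tw(1)[of k] by (auto simp: inner_add_right mult_le_0_iff)
  qed
  have lim: "(\<lambda>k. a \<bullet> ws k) \<longlonglongrightarrow> a \<bullet> w" by (intro tendsto_intros tw(2))
  show ?thesis by (rule LIMSEQ_le_const2[OF lim]) (use le in auto)
qed

text \<open>
  This is the part of the normal cone in the injectivity assumptions that the proof relies on:
  the active normals that are orthogonal to the direction \<open>w\<close>.
\<close>

lemma active_normal_mem_critical_normal_cone:
  assumes w: "w \<in> tangent_cone (halfspace_intersection H) d" and a: "a \<in> active_normals H d"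
    and aw: "a \<bullet> w = 0"
  shows "a \<in> limiting_normal_cone (tangent_cone (halfspace_intersection H) d) w"
proof -
  let ?T = "tangent_cone (halfspace_intersection H) d"
  have "a \<bullet> \<omega> \<le> 0" if "\<omega> \<in> tangent_cone ?T w" for \<omega>
  proof -
    obtain t ws where tw: "\<And>k. 0 < t k" "ws \<longlonglongrightarrow> \<omega>" "\<And>k. w + t k *\<^sub>R ws k \<in> ?T"
      using \<open>\<omega> \<in> _\<close> unfolding tangent_cone_def[of ?T] by blast
    have le: "a \<bullet> ws k \<le> 0" for k
      using active_normal_inner_tangent_le[OF tw(3)[of k] a] tw(1)[of k]
      by (auto simp: inner_add_right aw mult_le_0_iff)
    have lim: "(\<lambda>k. a \<bullet> ws k) \<longlonglongrightarrow> a \<bullet> \<omega>" by (intro tendsto_intros tw(2))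
    show ?thesis by (rule LIMSEQ_le_const2[OF lim]) (use le in auto)
  qed
  then have "a \<in> regular_normal_cone ?T w"
    using w by (simp add: regular_normal_cone_def polar_cone_def)
  then show ?thesis using regular_subset_limiting_normal_cone by blast
qed

text \<open>
  The derivative maps tangents of the preimage to tangents of the polyhedron, on which the
  multiplier is nonpositive.
\<close>

lemma multiplier_image_subset_regular_normal_cone:
  fixes h :: "'a::euclidean_space \<Rightarrow> 'b::euclidean_space"
  assumes derh: "(h has_derivative blinfun_apply L) (at z)"
    and z: "h z \<in> halfspace_intersection H"
    and l: "l \<in> convex_cone hull (active_normals H (h z))"
  shows "transpose_blinfun L l \<in> regular_normal_cone {z. h z \<in> halfspace_intersection H} z"
proof -
  let ?D = "halfspace_intersection H"
  have "w \<bullet> transpose_blinfun L l \<le> 0" if "w \<in> tangent_cone {z. h z \<in> ?D} z" for w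
  proof -
    obtain t ws where tw: "\<And>k::nat. 0 < t k" "t \<longlonglongrightarrow> 0" "ws \<longlonglongrightarrow> w" "\<And>k. h (z + t k *\<^sub>R ws k) \<in> ?D"
      using \<open>w \<in> _\<close> unfolding tangent_cone_def by blast
    have "L w \<in> tangent_cone ?D (h z)"
    proof (rule tangent_coneI_eventually[OF z tw(1,2)
          has_derivative_directional_sequentially[OF derh tw(1-3)]])
      show "\<forall>\<^sub>F k in sequentially. h z + t k *\<^sub>R ((h (z + t k *\<^sub>R ws k) - h z) /\<^sub>R t k) \<in> ?D"
        using tw(4) less_imp_neq[OF tw(1)] by (simp add: always_eventually)
    qed
    then have "l \<bullet> L w \<le> 0"
      by (intro convex_cone_hull_inner_le[OF l] active_normal_inner_tangent_le)
    then show ?thesis by (simp add: inner_transpose inner_commute)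
  qed
  then show ?thesis using z by (simp add: regular_normal_cone_def polar_cone_def inner_commute)
qed

text \<open>
  Every \<open>w\<close> with \<open>a \<bullet> L w \<le> 0\<close> for all active normals \<open>a\<close> is tangent to the preimage: injectivity
  of the transpose provides curves tangent to \<open>w\<close> on which each active constraint is affine in the
  step length. A regular normal is thus nonpositive on all such \<open>w\<close>, and the Farkas lemma
  represents it by a multiplier.
\<close>

lemma regular_normal_cone_subset_multiplier_image:
  fixes h :: "'a::euclidean_space \<Rightarrow> 'b::euclidean_space"
  assumes H: "finite H" and conth: "continuous_on UNIV h"
    and derh: "(h has_derivative blinfun_apply L) (at z)"
    and inj: "\<forall>\<mu>\<in>span (active_normals H (h z)). transpose_blinfun L \<mu> = 0 \<longrightarrow> \<mu> = 0"
  shows "regular_normal_cone {z. h z \<in> halfspace_intersection H} z \<subseteq>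
    transpose_blinfun L ` (convex_cone hull (active_normals H (h z)))"
proof
  let ?D = "halfspace_intersection H" and ?A = "active_normals H (h z)"
  fix zs assume zs: "zs \<in> regular_normal_cone {z. h z \<in> ?D} z"
  then have z: "h z \<in> ?D" and pol: "\<And>w. w \<in> tangent_cone {z. h z \<in> ?D} z \<Longrightarrow> zs \<bullet> w \<le> 0"
    by (auto simp: regular_normal_cone_def polar_cone_def split: if_splits)
  have lin: "linear (transpose_blinfun L)" by (rule blinfun_linear)
  have "zs \<in> convex_cone hull (transpose_blinfun L ` ?A)"
  proof (rule Farkas_convex_cone_hull)
    show "finite (transpose_blinfun L ` ?A)" using H by (simp add: finite_active_normals)
  next
    fix w assume "\<And>c. c \<in> transpose_blinfun L ` ?A \<Longrightarrow> c \<bullet> w \<le> 0"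
    then have Lw: "a \<bullet> L w \<le> 0" if "a \<in> ?A" for a
      using that inner_transpose[of w L a] by (metis imageI inner_commute)
    obtain t ws where sol: "\<forall>k::nat. 0 < t k" "t \<longlonglongrightarrow> 0" "ws \<longlonglongrightarrow> w"
      "\<forall>k. \<forall>\<mu>\<in>span ?A. \<mu> \<bullet> h (z + t k *\<^sub>R ws k) = \<mu> \<bullet> (h z + t k *\<^sub>R L w)"
      by (rule tangential_solution_sequence[OF subspace_span conth derh inj, where v = w])
    note tw = sol(1)[rule_format] sol(2,3) sol(4)[rule_format]
    have "(\<lambda>k. z + t k *\<^sub>R ws k) \<longlonglongrightarrow> z"
      using tendsto_add[OF tendsto_const[of z] tendsto_scaleR[OF tw(2,3)]] by simp
    then have "(\<lambda>k. h (z + t k *\<^sub>R ws k)) \<longlonglongrightarrow> h z"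
      using conth by (intro continuous_on_tendsto_compose[OF conth]) auto
    then have "\<forall>\<^sub>F k in sequentially. h (z + t k *\<^sub>R ws k) \<in> ?D"
    proof (rule eventually_mem_halfspace_intersection[OF H z])
      fix k a assume "a \<in> ?A"
      then show "a \<bullet> h (z + t k *\<^sub>R ws k) \<le> a \<bullet> h z"
        using tw(4)[OF span_base] Lw[of a] tw(1)[of k]
        by (simp add: inner_add_right mult_nonneg_nonpos less_imp_le)
    qed
    then have "w \<in> tangent_cone {z. h z \<in> ?D} z"
      using z by (intro tangent_coneI_eventually[OF _ tw(1-3)]) auto
    then show "zs \<bullet> w \<le> 0" by (rule pol)
  qed
  then show "zs \<in> transpose_blinfun L ` (convex_cone hull ?A)"
    by (simp add: convex_cone_hull_linear_image[OF lin])
qed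

text \<open>
  The representation of regular normals holds at all points near \<open>z\<close>, because there the active
  normals are among those at \<open>z\<close> and injectivity is stable. By uniform injectivity the multipliers
  converge, and a finitely generated cone is closed.
\<close>

lemma limiting_normal_cone_subset_multiplier_image:
  fixes h :: "'a::euclidean_space \<Rightarrow> 'b::euclidean_space"
  assumes H: "finite H"
    and derh: "\<And>z. (h has_derivative blinfun_apply (h' z)) (at z)"
    and conth': "continuous_on UNIV h'"
    and inj: "\<forall>\<mu>\<in>span (active_normals H (h z)). transpose_blinfun (h' z) \<mu> = 0 \<longrightarrow> \<mu> = 0"
  shows "limiting_normal_cone {z. h z \<in> halfspace_intersection H} z \<subseteq>
    transpose_blinfun (h' z) ` (convex_cone hull (active_normals H (h z)))"
proof
  let ?D = "halfspace_intersection H" and ?A = "active_normals H (h z)"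
  fix zs assume "zs \<in> limiting_normal_cone {z. h z \<in> ?D} z"
  then obtain zk zsk where z: "h z \<in> ?D" and zk: "zk \<longlonglongrightarrow> z" and zsk: "zsk \<longlonglongrightarrow> zs"
    and reg: "\<And>k::nat. zsk k \<in> regular_normal_cone {z. h z \<in> ?D} (zk k)"
    unfolding limiting_normal_cone_def by blast
  have conth: "continuous_on UNIV h"
    using derh by (intro continuous_at_imp_continuous_on ballI has_derivative_continuous)
  have hk: "(\<lambda>k. h (zk k)) \<longlonglongrightarrow> h z"
    by (rule continuous_on_tendsto_compose[OF conth zk]) auto
  have "(\<lambda>k. h' (zk k)) \<longlonglongrightarrow> h' z"
    by (rule continuous_on_tendsto_compose[OF conth' zk]) auto
  then have Bk: "(\<lambda>k. transpose_blinfun (h' (zk k))) \<longlonglongrightarrow> transpose_blinfun (h' z)"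
    by (rule bounded_linear.tendsto[OF bounded_linear_transpose_blinfun])
  obtain c where c: "c > 0"
    "\<forall>\<^sub>F k in sequentially. \<forall>\<mu>\<in>span ?A. c * norm \<mu> \<le> norm (transpose_blinfun (h' (zk k)) \<mu>)"
    using injective_eventually_bounded_below[OF subspace_span inj Bk] by blast
  have "\<forall>\<^sub>F k in sequentially. \<exists>l \<in> convex_cone hull ?A. zsk k = transpose_blinfun (h' (zk k)) l"
    using c(2) eventually_active_normals_subset[OF H z hk]
  proof eventually_elim
    case (elim k)
    have "\<forall>\<mu>\<in>span (active_normals H (h (zk k))). transpose_blinfun (h' (zk k)) \<mu> = 0 \<longrightarrow> \<mu> = 0"
      using elim(1) span_mono[OF elim(2)] c(1) by (fastforce simp: mult_le_0_iff)
    from regular_normal_cone_subset_multiplier_image[OF H conth derh this] reg[of k]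
    show ?case using hull_mono[OF elim(2), of convex_cone] by blast
  qed
  then obtain K where "\<forall>k\<ge>K. \<exists>l \<in> convex_cone hull ?A. zsk k = transpose_blinfun (h' (zk k)) l"
    unfolding eventually_sequentially by blast
  then have "\<forall>k. \<exists>l \<in> convex_cone hull ?A. zsk (k + K) = transpose_blinfun (h' (zk (k + K))) l"
    by simp
  then obtain l where l: "\<And>k. l k \<in> convex_cone hull ?A"
    "\<And>k. zsk (k + K) = transpose_blinfun (h' (zk (k + K))) (l k)"
    by metis
  have "(\<lambda>k. transpose_blinfun (h' (zk (k + K))) (l k)) \<longlonglongrightarrow> zs"
    using LIMSEQ_ignore_initial_segment[OF zsk, of K] by (simp add: l(2))
  then obtain l' where l': "l \<longlonglongrightarrow> l'" "transpose_blinfun (h' z) l' = zs"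
    using preimages_converge_if_images_converge[OF subspace_span inj
        LIMSEQ_ignore_initial_segment[OF Bk, of K], of l] l(1) convex_cone_hull_subset_span by blast
  have "closed (convex_cone hull ?A)"
    using H by (intro polyhedron_imp_closed polyhedron_convex_cone_hull finite_active_normals)
  then have "l' \<in> convex_cone hull ?A"
    using closed_sequentially l(1) l'(1) by blast
  then show "zs \<in> transpose_blinfun (h' z) ` (convex_cone hull ?A)" using l'(2) by blast
qed

section \<open>Multiplier systems over a polyhedron\<close>

text \<open>
  Along a curve on which the inner products of \<open>G\<close> with the vectors in \<open>J\<close> are constant, active
  constraints remain active, so every multiplier admissible at \<open>y\<close> remains admissible. Moving the
  multiplier along \<open>\<eta>\<close> at the same time stays in the graph of \<open>N\<close>, and the product rule for \<open>B y l\<close>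
  gives the tangent direction.
\<close>

lemma graph_tangent_direction:
  fixes G :: "'a::euclidean_space \<Rightarrow> 'b::euclidean_space"
    and B :: "'a \<Rightarrow> 'b \<Rightarrow>\<^sub>L 'c::euclidean_space"
  assumes H: "finite H" and contG: "continuous_on UNIV G"
    and derG: "(G has_derivative blinfun_apply L) (at y)"
    and derB: "(B has_derivative B') (at y)"
    and sub: "\<And>y l. G y \<in> halfspace_intersection H \<Longrightarrow>
      l \<in> convex_cone hull (active_normals H (G y)) \<Longrightarrow> B y l \<in> N y"
    and Gy: "G y \<in> halfspace_intersection H" and act: "active_normals H (G y) \<subseteq> J"
    and inj: "\<forall>\<mu>\<in>span J. transpose_blinfun L \<mu> = 0 \<longrightarrow> \<mu> = 0"
    and \<eta>: "\<exists>\<delta>>0. \<forall>s. 0 \<le> s \<and> s \<le> \<delta> \<longrightarrow> l + s *\<^sub>R \<eta> \<in> convex_cone hull (active_normals H (G y))"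
    and v: "\<forall>a\<in>J. a \<bullet> L v = 0"
  shows "(v, B' v l + B y \<eta>) \<in> tangent_cone (gph N) (y, B y l)"
proof -
  let ?D = "halfspace_intersection H"
  obtain \<delta> where \<delta>: "\<delta> > 0"
    "\<And>s. 0 \<le> s \<Longrightarrow> s \<le> \<delta> \<Longrightarrow> l + s *\<^sub>R \<eta> \<in> convex_cone hull (active_normals H (G y))"
    using \<eta> by blast
  have l: "l \<in> convex_cone hull (active_normals H (G y))"
    using \<delta>(2)[of 0] \<delta>(1) by simp
  obtain t ws where "\<forall>k::nat. 0 < t k" and t2: "t \<longlonglongrightarrow> 0" and ws: "ws \<longlonglongrightarrow> v"
    and sol: "\<forall>k. \<forall>\<mu>\<in>span J. \<mu> \<bullet> G (y + t k *\<^sub>R ws k) = \<mu> \<bullet> (G y + t k *\<^sub>R L v)"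
    by (rule tangential_solution_sequence[OF subspace_span contG derG inj, where v = v])
  then have t: "\<And>k. 0 < t k" "t \<longlonglongrightarrow> 0" by auto
  have G_eq: "a \<bullet> G (y + t k *\<^sub>R ws k) = a \<bullet> G y" if "a \<in> J" for a k
    using sol span_base[OF that] v that by (simp add: inner_add_right)
  define q where "q = (\<lambda>k. (B (y + t k *\<^sub>R ws k) - B y) /\<^sub>R t k)"
  have q: "q \<longlonglongrightarrow> B' v"
    unfolding q_def by (rule has_derivative_directional_sequentially[OF derB t ws])
  have yk: "(\<lambda>k. y + t k *\<^sub>R ws k) \<longlonglongrightarrow> y"
    using tendsto_add[OF tendsto_const[of y] tendsto_scaleR[OF t(2) ws]] by simp
  have Byk: "(\<lambda>k. B (y + t k *\<^sub>R ws k)) \<longlonglongrightarrow> B y"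
    using has_derivative_continuous[OF derB] yk by (auto simp: continuous_at_sequentially o_def)
  have Gyk: "(\<lambda>k. G (y + t k *\<^sub>R ws k)) \<longlonglongrightarrow> G y"
    by (rule continuous_on_tendsto_compose[OF contG yk]) auto
  define u where "u = (\<lambda>k. q k l + B (y + t k *\<^sub>R ws k) \<eta>)"
  have u: "u \<longlonglongrightarrow> B' v l + B y \<eta>"
    unfolding u_def by (intro tendsto_intros blinfun.tendsto q Byk)
  have small: "\<forall>\<^sub>F k in sequentially. t k \<le> \<delta>"
    using order_tendstoD(2)[OF t(2) \<delta>(1)] by eventually_elim simp
  have feasible: "\<forall>\<^sub>F k in sequentially. G (y + t k *\<^sub>R ws k) \<in> ?D"
    by (rule eventually_mem_halfspace_intersection[OF H Gy Gyk]) (use G_eq act in auto)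
  show ?thesis
  proof (rule tangent_coneI_eventually[OF _ t, where ws = "\<lambda>k. (ws k, u k)"])
    show "(y, B y l) \<in> gph N" using sub[OF Gy l] by (simp add: gph_def)
    show "(\<lambda>k. (ws k, u k)) \<longlonglongrightarrow> (v, B' v l + B y \<eta>)" by (intro tendsto_Pair ws u)
    show "\<forall>\<^sub>F k in sequentially. (y, B y l) + t k *\<^sub>R (ws k, u k) \<in> gph N"
      using feasible small
    proof eventually_elim
      case (elim k)
      let ?y = "y + t k *\<^sub>R ws k"
      have "active_normals H (G y) \<subseteq> active_normals H (G ?y)"
        using G_eq act by (auto simp: active_normals_def)
      then have "l + t k *\<^sub>R \<eta> \<in> convex_cone hull (active_normals H (G ?y))"
        using \<delta>(2)[of "t k"] t(1)[of k] elim(2) hull_mono by (metis less_imp_le subsetD)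
      from sub[OF elim(1) this] have "B ?y (l + t k *\<^sub>R \<eta>) \<in> N ?y" .
      moreover have "B ?y (l + t k *\<^sub>R \<eta>) = B y l + t k *\<^sub>R u k"
        using t(1)[of k]
        by (simp add: u_def q_def blinfun.bilinear_simps scaleR_add_right)
      ultimately show ?case by (simp add: gph_def)
    qed
  qed
qed

text \<open>
  The statement separates the polyhedral argument from the constraint system: all that enters
  about \<open>N\<close> is that \<open>N y\<close> is empty unless \<open>G y\<close> lies in the polyhedron, and that \<open>B y\<close> maps
  admissible multipliers into \<open>N y\<close>, and reaches all of \<open>N y\<close> where it is injective on the span of the active normals.
\<close>

lemma semismooth_star_multiplier_system:
  fixes G :: "'a::euclidean_space \<Rightarrow> 'b::euclidean_space"
    and B :: "'a \<Rightarrow> 'b \<Rightarrow>\<^sub>L 'c::euclidean_space"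
  assumes H: "finite H"
    and derG: "\<And>y. (G has_derivative blinfun_apply (G' y)) (at y)"
    and contG': "continuous_on UNIV G'"
    and derB: "\<And>y. (B has_derivative blinfun_apply (B' y)) (at y)"
    and contB': "continuous_on UNIV B'"
    and sub: "\<And>y l. G y \<in> halfspace_intersection H \<Longrightarrow>
      l \<in> convex_cone hull (active_normals H (G y)) \<Longrightarrow> B y l \<in> N y"
    and sup: "\<And>y. \<forall>\<mu>\<in>span (active_normals H (G y)). B y \<mu> = 0 \<longrightarrow> \<mu> = 0 \<Longrightarrow>
      N y \<subseteq> B y ` (convex_cone hull (active_normals H (G y)))"
    and dom: "\<And>y x. x \<in> N y \<Longrightarrow> G y \<in> halfspace_intersection H"
    and injG: "\<forall>\<mu>\<in>span (limiting_normal_cone (tangent_cone (halfspace_intersection H) (G y)) (G' y v)).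
      transpose_blinfun (G' y) \<mu> = 0 \<longrightarrow> \<mu> = 0"
    and injB: "\<forall>\<mu>\<in>span (limiting_normal_cone (tangent_cone (halfspace_intersection H) (G y)) (G' y v)).
      B y \<mu> = 0 \<longrightarrow> \<mu> = 0"
  shows "semismooth_star_in_direction N (y, xs) (v, us)"
proof -
  let ?D = "halfspace_intersection H"
  have contG: "continuous_on UNIV G"
    using derG by (intro continuous_at_imp_continuous_on ballI has_derivative_continuous)
  have contB: "continuous_on UNIV B"
    using derB by (intro continuous_at_imp_continuous_on ballI has_derivative_continuous)
  have "v \<bullet> w = us \<bullet> ws"
    if "(w, - ws) \<in> dir_limiting_normal_cone (gph N) (y, xs) (v, us)" for w ws
  proof -
    obtain t d n where t: "\<And>k::nat. 0 < t k" "t \<longlonglongrightarrow> 0" and d: "d \<longlonglongrightarrow> (v, us)"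
      and n: "n \<longlonglongrightarrow> (w, - ws)"
      and reg: "\<And>k. n k \<in> regular_normal_cone (gph N) ((y, xs) + t k *\<^sub>R d k)"
      and base: "(y, xs) \<in> gph N"
      using \<open>(w, - ws) \<in> _\<close> unfolding dir_limiting_normal_cone_def by blast
    define vk where "vk = (\<lambda>k. fst (d k))"
    define uk where "uk = (\<lambda>k. snd (d k))"
    have vk: "vk \<longlonglongrightarrow> v" and uk: "uk \<longlonglongrightarrow> us"
      using tendsto_fst[OF d] tendsto_snd[OF d] by (simp_all add: vk_def uk_def)
    define yk where "yk = (\<lambda>k. y + t k *\<^sub>R vk k)"
    define xk where "xk = (\<lambda>k. xs + t k *\<^sub>R uk k)"
    have zk: "(y, xs) + t k *\<^sub>R d k = (yk k, xk k)" for k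
      by (simp add: yk_def xk_def vk_def uk_def prod_eq_iff)
    have yk: "yk \<longlonglongrightarrow> y"
      using tendsto_add[OF tendsto_const[of y] tendsto_scaleR[OF t(2) vk]] by (simp add: yk_def)
    have xk: "xk \<longlonglongrightarrow> xs"
      using tendsto_add[OF tendsto_const[of xs] tendsto_scaleR[OF t(2) uk]] by (simp add: xk_def)
    have xkN: "xk k \<in> N (yk k)" for k
      using reg[of k] by (auto simp: zk regular_normal_cone_def gph_def split: if_splits)
    have Gyk: "G (yk k) \<in> ?D" for k using dom xkN by blast
    have Gy: "G y \<in> ?D" using base dom by (auto simp: gph_def)
    have Gyk_lim: "(\<lambda>k. G (yk k)) \<longlonglongrightarrow> G y"
      by (rule continuous_on_tendsto_compose[OF contG yk]) auto
    have Byk: "(\<lambda>k. B (yk k)) \<longlonglongrightarrow> B y"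
      by (rule continuous_on_tendsto_compose[OF contB yk]) auto
    have G'yk: "(\<lambda>k. G' (yk k)) \<longlonglongrightarrow> G' y"
      by (rule continuous_on_tendsto_compose[OF contG' yk]) auto
    have B'yk: "(\<lambda>k. B' (yk k)) \<longlonglongrightarrow> B' y"
      by (rule continuous_on_tendsto_compose[OF contB' yk]) auto
    have quot: "(\<lambda>k. (G (yk k) - G y) /\<^sub>R t k) \<longlonglongrightarrow> G' y v"
      unfolding yk_def by (rule has_derivative_directional_sequentially[OF derG t vk])
    have crit: "G' y v \<in> tangent_cone ?D (G y)"
      by (rule tangent_coneI_eventually[OF Gy t quot])
        (use Gyk less_imp_neq[OF t(1)] in \<open>simp add: always_eventually\<close>)
    \<comment> \<open>the critical normals, which comprise all active normals along the tail of the sequence\<close>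
    define J0 where "J0 = {a \<in> active_normals H (G y). a \<bullet> G' y v = 0}"
    have "J0 \<subseteq> limiting_normal_cone (tangent_cone ?D (G y)) (G' y v)"
      unfolding J0_def using active_normal_mem_critical_normal_cone[OF crit] by blast
    then have J0: "span J0 \<subseteq> span (limiting_normal_cone (tangent_cone ?D (G y)) (G' y v))"
      by (rule span_mono)
    have injG0: "\<forall>\<mu>\<in>span J0. transpose_blinfun (G' y) \<mu> = 0 \<longrightarrow> \<mu> = 0" using injG J0 by blast
    have injB0: "\<forall>\<mu>\<in>span J0. B y \<mu> = 0 \<longrightarrow> \<mu> = 0" using injB J0 by blast

    \<comment> \<open>an active normal with \<open>a \<bullet> G' y v < 0\<close> becomes inactive along the sequence\<close>
    have act_ev: "\<forall>\<^sub>F k in sequentially. active_normals H (G (yk k)) \<subseteq> J0"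
    proof -
      have "\<forall>\<^sub>F k in sequentially. a \<in> active_normals H (G (yk k)) \<longrightarrow> a \<bullet> G' y v = 0"
        if a: "a \<in> active_normals H (G y)" for a
      proof (cases "a \<bullet> G' y v = 0")
        case False
        then have neg: "a \<bullet> G' y v < 0"
          using active_normal_inner_tangent_le[OF crit a] by simp
        have "(\<lambda>k. a \<bullet> ((G (yk k) - G y) /\<^sub>R t k)) \<longlonglongrightarrow> a \<bullet> G' y v"
          by (intro tendsto_intros quot)
        from order_tendstoD(2)[OF this neg] show ?thesis
        proof eventually_elim
          case (elim k)
          have "a \<bullet> ((G (yk k) - G y) /\<^sub>R t k) = (a \<bullet> G (yk k) - a \<bullet> G y) / t k"
            by (simp add: inner_diff_right divide_inverse mult.commute)
          then have "a \<bullet> G (yk k) < a \<bullet> G y"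
            using elim t(1)[of k] by (simp add: divide_less_0_iff)
          then show ?case using Gy by (force simp: active_normals_def halfspace_intersection_def)
        qed
      qed simp
      then have "\<forall>\<^sub>F k in sequentially. \<forall>a\<in>active_normals H (G y).
          a \<in> active_normals H (G (yk k)) \<longrightarrow> a \<bullet> G' y v = 0"
        using finite_active_normals[OF H] by (simp add: eventually_ball_finite)
      with eventually_active_normals_subset[OF H Gy Gyk_lim] show ?thesis
        by eventually_elim (auto simp: J0_def)
    qed

    obtain c where c: "c > 0"
      "\<forall>\<^sub>F k in sequentially. \<forall>\<mu>\<in>span J0. c * norm \<mu> \<le> norm (transpose_blinfun (G' (yk k)) \<mu>)"
      using injective_eventually_bounded_below[OF subspace_span injG0
          bounded_linear.tendsto[OF bounded_linear_transpose_blinfun G'yk]] by blast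
    obtain cB where cB: "cB > 0"
      "\<forall>\<^sub>F k in sequentially. \<forall>\<mu>\<in>span J0. cB * norm \<mu> \<le> norm (B (yk k) \<mu>)"
      using injective_eventually_bounded_below[OF subspace_span injB0 Byk] by blast
    define good where "good = (\<lambda>k l J. active_normals H (G (yk k)) \<subseteq> J0 \<and>
      (\<forall>\<mu>\<in>span J0. c * norm \<mu> \<le> norm (transpose_blinfun (G' (yk k)) \<mu>)) \<and>
      xk k = B (yk k) l \<and> J \<subseteq> active_normals H (G (yk k)) \<and> l \<in> span J \<and>
      (\<forall>\<eta>\<in>span J. \<exists>\<delta>>0. \<forall>s. 0 \<le> s \<and> s \<le> \<delta> \<longrightarrow>
        l + s *\<^sub>R \<eta> \<in> convex_cone hull (active_normals H (G (yk k)))))"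
    have "\<forall>\<^sub>F k in sequentially. \<exists>l J. good k l J"
      using act_ev c(2) cB(2)
    proof eventually_elim
      case (elim k)
      have "\<forall>\<mu>\<in>span (active_normals H (G (yk k))). B (yk k) \<mu> = 0 \<longrightarrow> \<mu> = 0"
        using elim(3) span_mono[OF elim(1)] cB(1) by (fastforce simp: mult_le_0_iff)
      from sup[OF this] xkN obtain l where
        l: "l \<in> convex_cone hull (active_normals H (G (yk k)))" "xk k = B (yk k) l" by blast
      obtain J where "J \<subseteq> active_normals H (G (yk k))" "l \<in> span J"
        "\<forall>\<eta>\<in>span J. \<exists>\<delta>>0. \<forall>s. 0 \<le> s \<and> s \<le> \<delta> \<longrightarrow>
          l + s *\<^sub>R \<eta> \<in> convex_cone hull (active_normals H (G (yk k)))"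
        using convex_cone_hull_support[OF l(1)] by blast
      then have "good k l J" using elim(1,2) l(2) by (simp add: good_def)
      then show ?case by blast
    qed
    then obtain K where "\<forall>k\<ge>K. \<exists>l J. good k l J"
      unfolding eventually_sequentially by blast
    then obtain l J where good: "\<And>k. k \<ge> K \<Longrightarrow> good k (l k) (J k)" by metis
    have "J k \<in> Pow (fst ` H)" if "k \<ge> K" for k
    proof -
      have "J k \<subseteq> active_normals H (G (yk k))"
        using good[OF that] by (simp add: good_def)
      then show ?thesis using active_normals_subset[of H "G (yk k)"] by simp
    qed
    then have "finite (J ` {K..})"
      using H by (auto intro: finite_subset[of "J ` {K..}" "Pow (fst ` H)"])
    \<comment> \<open>there are only finitely many supports, so one of them occurs infinitely often\<close>
    from pigeonhole_infinite[OF infinite_Ici this]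
    obtain k0 where "infinite {k \<in> {K..}. J k = J k0}" by auto
    from infinite_enumerate[OF this]
    obtain r :: "nat \<Rightarrow> nat" where r: "strict_mono r" "\<forall>k. r k \<in> {k \<in> {K..}. J k = J k0}" by auto
    define J' where "J' = J k0"
    have good_r: "good (r k) (l (r k)) J'" for k using good[of "r k"] r(2) by (simp add: J'_def)
    have "J' \<subseteq> J0" using good_r[of 0] by (auto simp: good_def)
    then have injB': "\<forall>\<mu>\<in>span J'. B y \<mu> = 0 \<longrightarrow> \<mu> = 0" using injB0 span_mono by blast
    note sub_r = LIMSEQ_subseq_LIMSEQ[OF _ r(1), unfolded o_def]
    have lV: "l (r k) \<in> span J'" and xkl: "xk (r k) = B (yk (r k)) (l (r k))" for k
      using good_r[of k] by (simp_all add: good_def)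
    have "(\<lambda>k. B (yk (r k)) (l (r k))) \<longlonglongrightarrow> xs" using sub_r[OF xk] by (simp add: xkl)
    then obtain l' where l': "l' \<in> span J'" "(\<lambda>k. l (r k)) \<longlonglongrightarrow> l'" "B y l' = xs"
      using preimages_converge_if_images_converge[OF subspace_span injB' sub_r[OF Byk], of "\<lambda>k. l (r k)"] lV
      by blast

    \<comment> \<open>difference quotients of the multipliers; they stay in \<open>span J'\<close> because the
         multipliers and their limit \<open>l'\<close> do\<close>
    define \<theta> where "\<theta> = (\<lambda>k. (l (r k) - l') /\<^sub>R t (r k))"
    have \<theta>V: "\<theta> k \<in> span J'" for k
      unfolding \<theta>_def using lV l'(1) by (intro span_scale span_diff)
    have "B (yk (r k)) (\<theta> k) = uk (r k) - ((B (yk (r k)) - B y) /\<^sub>R t (r k)) l'" for k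
    proof -
      have "B (yk (r k)) (\<theta> k) = (xk (r k) - B (yk (r k)) l') /\<^sub>R t (r k)"
        by (simp add: \<theta>_def blinfun.bilinear_simps xkl)
      also have "xk (r k) = B y l' + t (r k) *\<^sub>R uk (r k)" by (simp add: xk_def l'(3))
      finally show ?thesis
        using t(1)[of "r k"] by (simp add: blinfun.bilinear_simps algebra_simps)
    qed
    moreover have "(\<lambda>k. (B (yk k) - B y) /\<^sub>R t k) \<longlonglongrightarrow> B' y v"
      unfolding yk_def by (rule has_derivative_directional_sequentially[OF derB t vk])
    ultimately have "(\<lambda>k. B (yk (r k)) (\<theta> k)) \<longlonglongrightarrow> us - B' y v l'"
      using tendsto_diff[OF sub_r[OF uk] blinfun.tendsto[OF sub_r tendsto_const]] by auto
    then obtain \<eta> where \<eta>: "\<eta> \<in> span J'" "B y \<eta> = us - B' y v l'"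
      using preimages_converge_if_images_converge[OF subspace_span injB' sub_r[OF Byk], of \<theta>] \<theta>V
      by blast

    \<comment> \<open>a correction of \<open>v\<close> that makes the image orthogonal to the critical normals, as it is at \<open>y\<close>\<close>
    have "\<exists>v'. (\<forall>a\<in>J0. a \<bullet> G' (yk (r k)) v' = 0) \<and>
        norm (v' - v) \<le> norm (G' (yk (r k)) v - G' y v) / c" for k
    proof -
      have bel: "\<forall>\<mu>\<in>span J0. c * norm \<mu> \<le> norm (transpose_blinfun (G' (yk (r k))) \<mu>)"
        using good_r[of k] by (simp add: good_def)
      obtain R where "bounded_linear R"
        and R: "\<forall>\<xi>. \<forall>\<mu>\<in>span J0. \<mu> \<bullet> G' (yk (r k)) (R \<xi>) = \<mu> \<bullet> \<xi>"
          "\<forall>\<xi>. norm (R \<xi>) \<le> norm \<xi> / c"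
        by (rule right_inverse_modulo_subspace[OF subspace_span c(1) bel])
      let ?v' = "v - R (G' (yk (r k)) v - G' y v)"
      have "a \<bullet> G' (yk (r k)) ?v' = 0" if "a \<in> J0" for a
        using R(1) that
        by (simp add: blinfun.diff_right inner_diff_right span_base) (simp add: J0_def)
      moreover have "norm (?v' - v) \<le> norm (G' (yk (r k)) v - G' y v) / c" using R(2) by simp
      ultimately show ?thesis by blast
    qed
    then obtain v' where v': "\<And>k. \<forall>a\<in>J0. a \<bullet> G' (yk (r k)) (v' k) = 0"
      "\<And>k. norm (v' k - v) \<le> norm (G' (yk (r k)) v - G' y v) / c" by metis
    have bound_lim: "(\<lambda>k. norm (G' (yk (r k)) v - G' y v) / c) \<longlonglongrightarrow> 0"
      using tendsto_norm_zero[OF LIM_zero[OF blinfun.tendsto[OF sub_r[OF G'yk] tendsto_const]]]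
      by (rule tendsto_divide_zero)
    have v'_lim: "v' \<longlonglongrightarrow> v"
      by (rule LIM_zero_cancel, rule Lim_null_comparison[OF _ bound_lim])
        (simp add: v'(2) always_eventually)

    \<comment> \<open>the second component of the tangent direction at the \<open>r k\<close>-th graph point\<close>
    define u' where "u' = (\<lambda>k. B' (yk (r k)) (v' k) (l (r k)) + B (yk (r k)) \<eta>)"
    have "u' \<longlonglongrightarrow> B' y v l' + B y \<eta>"
      unfolding u'_def
      by (intro tendsto_add blinfun.tendsto sub_r[OF B'yk] sub_r[OF Byk] v'_lim l'(2) tendsto_const)
    then have u'_lim: "u' \<longlonglongrightarrow> us" by (simp add: \<eta>(2))
    have "n (r k) \<bullet> (v' k, u' k) = 0" for k
    proof -
      \<comment> \<open>both signs are tangent, since \<open>span J'\<close> and the condition on \<open>v'\<close> are symmetric\<close>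
      have tangent: "(\<sigma> *\<^sub>R v' k, \<sigma> *\<^sub>R u' k) \<in> tangent_cone (gph N) (yk (r k), xk (r k))"
        if "\<sigma> = 1 \<or> \<sigma> = -1" for \<sigma> :: real
      proof -
        have bel: "\<forall>\<mu>\<in>span J0. c * norm \<mu> \<le> norm (transpose_blinfun (G' (yk (r k))) \<mu>)"
          and act: "active_normals H (G (yk (r k))) \<subseteq> J0"
          and supp: "\<forall>\<eta>\<in>span J'. \<exists>\<delta>>0. \<forall>s. 0 \<le> s \<and> s \<le> \<delta> \<longrightarrow>
            l (r k) + s *\<^sub>R \<eta> \<in> convex_cone hull (active_normals H (G (yk (r k))))"
          using good_r[of k] by (simp_all add: good_def)
        have inj: "\<forall>\<mu>\<in>span J0. transpose_blinfun (G' (yk (r k))) \<mu> = 0 \<longrightarrow> \<mu> = 0"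
          using bel c(1) by (fastforce simp: mult_le_0_iff)
        have "\<sigma> *\<^sub>R \<eta> \<in> span J'" using \<eta>(1) by (rule span_scale)
        from graph_tangent_direction[where N = N, OF H contG derG derB sub Gyk act inj supp[rule_format, OF this], where v = "\<sigma> *\<^sub>R v' k"]
        have "(\<sigma> *\<^sub>R v' k, B' (yk (r k)) (\<sigma> *\<^sub>R v' k) (l (r k)) + B (yk (r k)) (\<sigma> *\<^sub>R \<eta>))
            \<in> tangent_cone (gph N) (yk (r k), B (yk (r k)) (l (r k)))"
          using v'(1)[of k] by (simp add: blinfun.bilinear_simps)
        then show ?thesis
          by (simp add: u'_def blinfun.bilinear_simps scaleR_add_right xkl)
      qed
      have pol: "n (r k) \<bullet> p \<le> 0" if "p \<in> tangent_cone (gph N) (yk (r k), xk (r k))" for p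
        using reg[of "r k"] that by (auto simp: zk regular_normal_cone_def polar_cone_def split: if_splits)
      show ?thesis
        using pol[OF tangent[of 1]] pol[OF tangent[of "-1"]]
        by (simp add: inner_Pair_0 inner_prod_def)
    qed
    moreover have "(\<lambda>k. n (r k) \<bullet> (v' k, u' k)) \<longlonglongrightarrow> (w, - ws) \<bullet> (v, us)"
      by (intro tendsto_inner sub_r[OF n] tendsto_Pair v'_lim u'_lim)
    ultimately have "(w, - ws) \<bullet> (v, us) = 0"
      by (simp add: LIMSEQ_const_iff)
    then show ?thesis by (simp add: inner_commute)
  qed
  then show ?thesis
    by (auto simp: semismooth_star_in_direction_def gph_def dir_limiting_coderivative_def)
qed

section \<open>Normal cones to the moving constraint set\<close>

definition diagonal_blinfun ::
    "('p::euclidean_space \<times> 'x::euclidean_space) \<Rightarrow>\<^sub>L ('p \<times> 'x \<times> 'x)" where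
  "diagonal_blinfun = Blinfun (\<lambda>y. (fst y, snd y, snd y))"

definition third_embedding_blinfun ::
    "'x::euclidean_space \<Rightarrow>\<^sub>L ('p::euclidean_space \<times> 'x \<times> 'x)" where
  "third_embedding_blinfun = Blinfun (\<lambda>u. (0, 0, u))"

lemma diagonal_blinfun_apply: "diagonal_blinfun (p, x) = (p, x, x)"
  unfolding diagonal_blinfun_def
  by (subst bounded_linear_Blinfun_apply) (auto intro!: bounded_linear_intros)

lemma third_embedding_blinfun_apply: "third_embedding_blinfun u = (0, 0, u)"
  unfolding third_embedding_blinfun_def
  by (subst bounded_linear_Blinfun_apply) (auto intro!: bounded_linear_intros)

lemma blinfun_compose_apply: "blinfun_apply (A o\<^sub>L B) = (\<lambda>x. A (B x))"
  by (simp add: fun_eq_iff)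

lemma has_derivative_third_argument:
  fixes g :: "'p::euclidean_space \<times> 'x::euclidean_space \<times> 'x \<Rightarrow> 's::euclidean_space"
  assumes "\<And>X. (g has_derivative blinfun_apply (g' X)) (at X)"
  shows "((\<lambda>z. g (p, x, z)) has_derivative blinfun_apply (g' (p, x, z) o\<^sub>L third_embedding_blinfun)) (at z)"
proof -
  have "((\<lambda>z. (p, x, z)) has_derivative blinfun_apply third_embedding_blinfun) (at z)"
    unfolding third_embedding_blinfun_apply by (intro derivative_intros)
  from has_derivative_compose[OF this assms] show ?thesis
    by (simp add: blinfun_compose_apply third_embedding_blinfun_apply)
qed

lemma has_derivative_g_tilde:
  fixes g :: "'p::euclidean_space \<times> 'x::euclidean_space \<times> 'x \<Rightarrow> 's::euclidean_space"
  assumes "\<And>X. (g has_derivative blinfun_apply (g' X)) (at X)"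
  shows "(g_tilde g has_derivative blinfun_apply (g' (diagonal_blinfun y) o\<^sub>L diagonal_blinfun)) (at y)"
proof -
  have "(blinfun_apply diagonal_blinfun has_derivative blinfun_apply diagonal_blinfun) (at y)"
    by (rule bounded_linear_imp_has_derivative[OF blinfun.bounded_linear_right])
  from has_derivative_compose[OF this assms] show ?thesis
    by (simp add: g_tilde_def case_prod_beta' blinfun_compose_apply flip: diagonal_blinfun_apply)
qed

lemma beta_eq:
  fixes g :: "'p::euclidean_space \<times> 'x::euclidean_space \<times> 'x \<Rightarrow> 's::euclidean_space"
  assumes "\<And>X. (g has_derivative blinfun_apply (g' X)) (at X)"
  shows "beta g y = blinfun_apply (g' (diagonal_blinfun y) o\<^sub>L third_embedding_blinfun)"
  using frechet_derivative_at[OF has_derivative_third_argument[OF assms, of "fst y" "snd y" "snd y"]]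
  by (cases y) (simp add: beta_def diagonal_blinfun_apply)

lemma normal_cone_map_supset_multipliers:
  fixes g :: "'p::euclidean_space \<times> 'x::euclidean_space \<times> 'x \<Rightarrow> 's::euclidean_space"
  assumes "\<And>X. (g has_derivative blinfun_apply (g' X)) (at X)"
    and "g_tilde g y \<in> halfspace_intersection H"
    and "l \<in> convex_cone hull (active_normals H (g_tilde g y))"
  shows "transpose_blinfun (g' (diagonal_blinfun y) o\<^sub>L third_embedding_blinfun) l
    \<in> normal_cone_map g (halfspace_intersection H) y"
proof (cases y)
  case (Pair p x)
  show ?thesis
    using multiplier_image_subset_regular_normal_cone[OF has_derivative_third_argument[OF assms(1)], of p x x H l]
      regular_subset_limiting_normal_cone assms(2,3)
    by (force simp: Pair normal_cone_map_def constraint_map_def g_tilde_def diagonal_blinfun_apply)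
qed

lemma normal_cone_map_subset_multipliers:
  fixes g :: "'p::euclidean_space \<times> 'x::euclidean_space \<times> 'x \<Rightarrow> 's::euclidean_space"
  assumes H: "finite H"
    and derg: "\<And>X. (g has_derivative blinfun_apply (g' X)) (at X)"
    and contg': "continuous_on UNIV g'"
    and inj: "\<forall>\<mu>\<in>span (active_normals H (g_tilde g y)).
      transpose_blinfun (g' (diagonal_blinfun y) o\<^sub>L third_embedding_blinfun) \<mu> = 0 \<longrightarrow> \<mu> = 0"
  shows "normal_cone_map g (halfspace_intersection H) y \<subseteq>
    transpose_blinfun (g' (diagonal_blinfun y) o\<^sub>L third_embedding_blinfun)
      ` (convex_cone hull (active_normals H (g_tilde g y)))"
proof (cases y)
  case (Pair p x)
  have "continuous_on UNIV (\<lambda>z. g' (p, x, z))"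
    by (rule continuous_on_compose2[OF contg']) (auto intro!: continuous_intros)
  then have "continuous_on UNIV (\<lambda>z. g' (p, x, z) o\<^sub>L third_embedding_blinfun)"
    by (intro continuous_intros)
  then show ?thesis
    using limiting_normal_cone_subset_multiplier_image[OF H has_derivative_third_argument[OF derg], of p x x] inj
    by (simp add: Pair normal_cone_map_def constraint_map_def g_tilde_def diagonal_blinfun_apply)
qed

theorem corollary5p6:
  fixes D :: "(real ^ 's) set"
    and g :: "(real ^ 'l) \<times> (real ^ 'n) \<times> (real ^ 'n) \<Rightarrow> real ^ 's"
    and p_bar :: "real ^ 'l" and x_bar :: "real ^ 'n"
  assumes "polyhedron D"
    and "twice_continuously_differentiable g"
    and "g (p_bar, x_bar, x_bar) \<in> D"
    and "\<exists>\<kappa>::real. \<kappa> > 0 \<and>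
          (\<forall>\<^sub>F (p, x, z) in nhds (p_bar, x_bar, x_bar).
             set_edist z (constraint_map g D (p, x)) \<le> ereal \<kappa> * set_edist (g (p, x, z)) D)"
  shows "\<forall>\<^sub>F y in nhds (p_bar, x_bar). \<forall>v :: (real ^ 'l) \<times> (real ^ 'n).
           (\<forall>\<mu>. adjoint (grad_g_tilde g y) \<mu> = 0 \<and>
                 \<mu> \<in> span (limiting_normal_cone (tangent_cone D (g_tilde g y)) (grad_g_tilde g y v))
               \<longrightarrow> \<mu> = 0) \<longrightarrow>
           (\<forall>\<mu>. adjoint (beta g y) \<mu> = 0 \<and>
                 \<mu> \<in> span (limiting_normal_cone (tangent_cone D (g_tilde g y)) (grad_g_tilde g y v))
               \<longrightarrow> \<mu> = 0) \<longrightarrow>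
           (\<forall>x_star u_star :: real ^ 'n.
              semismooth_star_in_direction (normal_cone_map g D) (y, x_star) (v, u_star))"
proof (intro always_eventually allI impI)
  fix y v :: "(real ^ 'l) \<times> (real ^ 'n)" and x_star u_star :: "real ^ 'n"
  assume grad: "\<forall>\<mu>. adjoint (grad_g_tilde g y) \<mu> = 0 \<and>
      \<mu> \<in> span (limiting_normal_cone (tangent_cone D (g_tilde g y)) (grad_g_tilde g y v)) \<longrightarrow> \<mu> = 0"
    and bet: "\<forall>\<mu>. adjoint (beta g y) \<mu> = 0 \<and>
      \<mu> \<in> span (limiting_normal_cone (tangent_cone D (g_tilde g y)) (grad_g_tilde g y v)) \<longrightarrow> \<mu> = 0"
  obtain H where H: "finite H" and D: "D = halfspace_intersection H"
    using polyhedron_eq_halfspace_intersection[OF assms(1)] by blast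
  obtain g' g'' where derg: "\<And>X. (g has_derivative blinfun_apply (g' X)) (at X)"
    and derg': "\<And>X. (g' has_derivative blinfun_apply (g'' X)) (at X)"
    and contg'': "continuous_on UNIV g''"
    using assms(2) unfolding twice_continuously_differentiable_def by blast
  have contg': "continuous_on UNIV g'"
    using derg' by (intro continuous_at_imp_continuous_on ballI has_derivative_continuous)
  define G' where "G' = (\<lambda>y. g' (diagonal_blinfun y) o\<^sub>L diagonal_blinfun)"
  define transposed_restriction :: "(((real ^ 'l) \<times> (real ^ 'n) \<times> (real ^ 'n)) \<Rightarrow>\<^sub>L (real ^ 's)) \<Rightarrow> ((real ^ 's) \<Rightarrow>\<^sub>L (real ^ 'n))"
    where "transposed_restriction = (\<lambda>M. transpose_blinfun (M o\<^sub>L third_embedding_blinfun))"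
  have bl: "bounded_linear transposed_restriction"
    unfolding transposed_restriction_def
    by (intro bounded_linear_compose[OF bounded_linear_transpose_blinfun]
        bounded_bilinear.bounded_linear_left[OF bounded_bilinear_blinfun_compose])
  define B where "B = (\<lambda>y. transposed_restriction (g' (diagonal_blinfun y)))"
  define B' where "B' = (\<lambda>y. Blinfun transposed_restriction o\<^sub>L (g'' (diagonal_blinfun y) o\<^sub>L diagonal_blinfun))"
  have cont_diag: "continuous_on UNIV (blinfun_apply diagonal_blinfun)"
    by (intro linear_continuous_on blinfun.bounded_linear_right)
  have derG: "(g_tilde g has_derivative blinfun_apply (G' y)) (at y)" for y
    unfolding G'_def by (rule has_derivative_g_tilde[OF derg])
  have grad_eq: "grad_g_tilde g y = blinfun_apply (G' y)"
    unfolding grad_g_tilde_def using frechet_derivative_at[OF derG] by simp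
  have adj_beta: "adjoint (beta g y) = blinfun_apply (B y)"
    unfolding B_def transposed_restriction_def beta_eq[OF derg] transpose_blinfun_apply ..
  have "semismooth_star_in_direction (normal_cone_map g (halfspace_intersection H)) (y, x_star) (v, u_star)"
  proof (rule semismooth_star_multiplier_system[where G = "g_tilde g" and G' = G' and B = B and B' = B', OF H derG])
    show "continuous_on UNIV G'"
      unfolding G'_def by (intro continuous_intros continuous_on_compose2[OF contg' cont_diag]) auto
  next
    fix y
    have "((\<lambda>y. g' (diagonal_blinfun y)) has_derivative
        (\<lambda>v. g'' (diagonal_blinfun y) (diagonal_blinfun v))) (at y)"
      by (rule has_derivative_compose[OF bounded_linear_imp_has_derivative[OF blinfun.bounded_linear_right] derg'])
    from bounded_linear.has_derivative[OF bl this]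
    show "(B has_derivative blinfun_apply (B' y)) (at y)"
      by (simp add: B_def B'_def blinfun_compose_apply bounded_linear_Blinfun_apply[OF bl])
  next
    show "continuous_on UNIV B'"
      unfolding B'_def by (intro continuous_intros continuous_on_compose2[OF contg'' cont_diag]) auto
  next
    fix y l
    assume "g_tilde g y \<in> halfspace_intersection H" "l \<in> convex_cone hull (active_normals H (g_tilde g y))"
    then show "B y l \<in> normal_cone_map g (halfspace_intersection H) y"
      unfolding B_def transposed_restriction_def by (rule normal_cone_map_supset_multipliers[OF derg])
  next
    fix y
    assume "\<forall>\<mu>\<in>span (active_normals H (g_tilde g y)). B y \<mu> = 0 \<longrightarrow> \<mu> = 0"
    then show "normal_cone_map g (halfspace_intersection H) y
        \<subseteq> B y ` (convex_cone hull (active_normals H (g_tilde g y)))"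
      unfolding B_def transposed_restriction_def
      by (rule normal_cone_map_subset_multipliers[OF H derg contg'])
  next
    fix y and x :: "real ^ 'n"
    assume "x \<in> normal_cone_map g (halfspace_intersection H) y"
    then show "g_tilde g y \<in> halfspace_intersection H"
      by (cases y) (simp add: normal_cone_map_def limiting_normal_cone_def constraint_map_def g_tilde_def)
  next
    show "\<forall>\<mu>\<in>span (limiting_normal_cone (tangent_cone (halfspace_intersection H) (g_tilde g y)) (G' y v)).
        transpose_blinfun (G' y) \<mu> = 0 \<longrightarrow> \<mu> = 0"
      using grad unfolding D grad_eq transpose_blinfun_apply by blast
    show "\<forall>\<mu>\<in>span (limiting_normal_cone (tangent_cone (halfspace_intersection H) (g_tilde g y)) (G' y v)).
        B y \<mu> = 0 \<longrightarrow> \<mu> = 0"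
      using bet unfolding D grad_eq adj_beta by blast
  qed
  then show "semismooth_star_in_direction (normal_cone_map g D) (y, x_star) (v, u_star)"
    by (simp only: D)
qed

end
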